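(* The following problem is undecidable: given $n\ge 1$ and $A_1,A_2,M\in\mathbb{Z}_{\max}^{n\times n}$, is there a finite sequence $1\le i_1,\dots,i_k\le 2$, $k\ge1$, such that $A_{i_1}\cdots A_{i_k}\sim M$?
   Context: $\mathbb{Z}_{\max}=(\mathbb{Z}\cup\{-\infty\},\max,+)$ is the max-plus semiring: its addition is $\max$ (zero element $-\infty$) and its multiplication is the usual $+$ (with $-\infty$ absorbing). Matrix products are taken in this semiring: $(AB)_{ij}=\max_k(A_{ik}+B_{kj})$. The proportionality relation $\sim$ on $\mathbb{Z}_{\max}^{n\times n}$ is defined by: $u\sim v$ if there is $\lambda\in\mathbb{R}$ such that $u_{ij}=\lambda+v_{ij}$ for all $i,j$ (with $\lambda+(-\infty)=-\infty$). *)

theory Defs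
  imports "Jordan_Normal_Form.Matrix" "HOL-Library.Nat_Bijection"
begin

section \<open>Max-plus semirings\<close>

datatype 'a maxplus = MInf | Fin 'a

type_synonym zmax = "int maxplus"
type_synonym rmax = "real maxplus"

text \<open>
  The semiring operations \<open>+\<close> and \<open>*\<close> are maximum and addition, so \<open>0\<close> is \<open>-\<infinity>\<close> and
  \<open>1\<close> is the number zero. With this instance, the product of matrices over \<^typ>\<open>zmax\<close> is the
  max-plus product.
\<close>

instantiation maxplus :: (linordered_ab_group_add) comm_semiring_1
begin

fun plus_maxplus :: "'a maxplus \<Rightarrow> 'a maxplus \<Rightarrow> 'a maxplus" where
  "plus_maxplus MInf y = y"
| "plus_maxplus x MInf = x"
| "plus_maxplus (Fin a) (Fin b) = Fin (max a b)"

fun times_maxplus :: "'a maxplus \<Rightarrow> 'a maxplus \<Rightarrow> 'a maxplus" where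
  "times_maxplus (Fin a) (Fin b) = Fin (a + b)"
| "times_maxplus _ _ = MInf"

definition zero_maxplus :: "'a maxplus" where "zero_maxplus = MInf"

definition one_maxplus :: "'a maxplus" where "one_maxplus = Fin 0"

instance
proof
  fix a b c :: "'a maxplus"
  show "a + b + c = a + (b + c)"
    by (cases a; cases b; cases c) (auto simp: max.assoc)
  show "a + b = b + a"
    by (cases a; cases b) (auto simp: max.commute)
  show "0 + a = a" "0 * a = 0" "a * 0 = 0"
    by (cases a; simp add: zero_maxplus_def)+
  show "a * b * c = a * (b * c)"
    by (cases a; cases b; cases c) (auto simp: add.assoc)
  show "a * b = b * a"
    by (cases a; cases b) (auto simp: add.commute)
  show "1 * a = a"
    by (cases a) (auto simp: one_maxplus_def)
  show "(a + b) * c = a * c + b * c"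
    by (cases a; cases b; cases c) (auto simp: max_add_distrib_left)
  show "(0 :: 'a maxplus) \<noteq> 1"
    by (simp add: zero_maxplus_def one_maxplus_def)
qed

end

abbreviation rmax_of_zmax :: "zmax \<Rightarrow> rmax" where
  "rmax_of_zmax \<equiv> map_maxplus real_of_int"

text \<open>The product with \<open>Fin c\<close> in \<^typ>\<open>rmax\<close> is \<open>x \<mapsto> c + x\<close>, fixing \<open>-\<infinity>\<close>.\<close>

definition proportional :: "zmax mat \<Rightarrow> zmax mat \<Rightarrow> bool" where
  "proportional u v \<longleftrightarrow>
     dim_row u = dim_row v \<and> dim_col u = dim_col v \<and>
     (\<exists>c::real. \<forall>i<dim_row v. \<forall>j<dim_col v.
        rmax_of_zmax (u $$ (i, j)) = Fin c * rmax_of_zmax (v $$ (i, j)))"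

definition mat_list_prod :: "nat \<Rightarrow> 'a :: semiring_1 mat list \<Rightarrow> 'a mat" where
  "mat_list_prod n As = foldr (*) As (1\<^sub>m n)"


section \<open>Partial recursive functions\<close>

text \<open>
  Kleene's schemes. Arities are not tracked: on argument lists of a fixed length \<open>k\<close>, a term
  denotes a partial recursive \<open>k\<close>-ary function (nowhere defined if the term is not well-formed
  for \<open>k\<close> arguments).
\<close>

datatype recfun =
    RZero
  | RSucc
  | RProj nat
  | RComp recfun "recfun list"
  | RPrim recfun recfun
  | RMu recfun

inductive rec_eval :: "recfun \<Rightarrow> nat list \<Rightarrow> nat \<Rightarrow> bool" where
  zero: "rec_eval RZero xs 0"
| succ: "rec_eval RSucc [x] (Suc x)"
| proj: "i < length xs \<Longrightarrow> rec_eval (RProj i) xs (xs ! i)"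
| comp: "list_all2 (\<lambda>g y. rec_eval g xs y) gs ys \<Longrightarrow> rec_eval f ys z \<Longrightarrow>
         rec_eval (RComp f gs) xs z"
| prim_0: "rec_eval f xs z \<Longrightarrow> rec_eval (RPrim f g) (0 # xs) z"
| prim_Suc: "rec_eval (RPrim f g) (n # xs) y \<Longrightarrow> rec_eval g (n # y # xs) z \<Longrightarrow>
             rec_eval (RPrim f g) (Suc n # xs) z"
| mu: "rec_eval f (n # xs) 0 \<Longrightarrow> (\<forall>m<n. \<exists>y. rec_eval f (m # xs) (Suc y)) \<Longrightarrow>
       rec_eval (RMu f) xs n"

inductive_cases rec_eval_RZeroE: "rec_eval RZero xs z"
inductive_cases rec_eval_RSuccE: "rec_eval RSucc xs z"
inductive_cases rec_eval_RProjE: "rec_eval (RProj i) xs z"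
inductive_cases rec_eval_RCompE: "rec_eval (RComp f gs) xs z"
inductive_cases rec_eval_RPrim_0E: "rec_eval (RPrim f g) (0 # xs) z"
inductive_cases rec_eval_RPrim_SucE: "rec_eval (RPrim f g) (Suc n # xs) z"
inductive_cases rec_eval_RMuE: "rec_eval (RMu f) xs z"

lemma rec_eval_deterministic:
  assumes "rec_eval f xs y" and "rec_eval f xs y'"
  shows "y = y'"
  using assms
proof (induction arbitrary: y' rule: rec_eval.induct)
  case (zero xs)
  then show ?case by (rule rec_eval_RZeroE) simp
next
  case (succ x)
  then show ?case by (rule rec_eval_RSuccE) simp
next
  case (proj i xs)
  from proj.prems show ?case by (rule rec_eval_RProjE) simp
next
  case (comp xs gs ys f z)
  from comp.prems show ?case
  proof (rule rec_eval_RCompE)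
    fix ys' assume ys': "list_all2 (\<lambda>g y. rec_eval g xs y) gs ys'" and z: "rec_eval f ys' y'"
    have "ys = ys'"
    proof (rule nth_equalityI)
      show "length ys = length ys'"
        using comp.IH(1)[THEN list_all2_lengthD] ys'[THEN list_all2_lengthD] by simp
      show "ys ! i = ys' ! i" if "i < length ys" for i
        using list_all2_nthD2[OF comp.IH(1) that] list_all2_nthD2[OF ys'] that
          \<open>length ys = length ys'\<close> by simp
    qed
    with z comp.IH(2) show ?thesis by simp
  qed
next
  case (prim_0 f xs z g)
  from prim_0.prems show ?case by (rule rec_eval_RPrim_0E) (rule prim_0.IH)
next
  case (prim_Suc f g n xs y z)
  from prim_Suc.prems show ?case
  proof (rule rec_eval_RPrim_SucE)
    fix u assume "rec_eval (RPrim f g) (n # xs) u" and u: "rec_eval g (n # u # xs) y'"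
    then have "y = u" by (intro prim_Suc.IH(1))
    with u show ?thesis by (intro prim_Suc.IH(2)) simp
  qed
next
  case (mu f n xs)
  from mu.prems show ?case
  proof (rule rec_eval_RMuE)
    assume y': "rec_eval f (y' # xs) 0" "\<forall>m<y'. \<exists>y. rec_eval f (m # xs) (Suc y)"
    have "\<not> n < y'"
      using y'(2) mu.IH(1) by fastforce
    moreover have "\<not> y' < n"
      using mu.IH(2) y'(1) by fastforce
    ultimately show ?thesis by simp
  qed
qed

text \<open>
  A decision problem is a set \<open>I\<close> of instances, a coding of instances by natural numbers and the
  property \<open>P\<close> to be decided. Nothing is required of the algorithm on numbers that are not codes
  of instances.
\<close>

definition decidable_problem :: "('i \<Rightarrow> nat) \<Rightarrow> 'i set \<Rightarrow> ('i \<Rightarrow> bool) \<Rightarrow> bool" where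
  "decidable_problem code I P \<longleftrightarrow>
     (\<exists>f. \<forall>x\<in>I. rec_eval f [code x] (if P x then 1 else 0))"


section \<open>Instances and their codes\<close>

type_synonym zmax_instance = "nat \<times> zmax mat \<times> zmax mat \<times> zmax mat"

definition zmax_instances :: "zmax_instance set" where
  "zmax_instances =
     {(n, A\<^sub>1, A\<^sub>2, M). 1 \<le> n \<and> A\<^sub>1 \<in> carrier_mat n n \<and> A\<^sub>2 \<in> carrier_mat n n \<and> M \<in> carrier_mat n n}"

fun zmax_code :: "zmax \<Rightarrow> nat" where
  "zmax_code MInf = 0"
| "zmax_code (Fin z) = Suc (int_encode z)"

definition zmax_mat_code :: "zmax mat \<Rightarrow> nat" where
  "zmax_mat_code A = list_encode (map (list_encode \<circ> map zmax_code) (mat_to_list A))"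

fun instance_code :: "zmax_instance \<Rightarrow> nat" where
  "instance_code (n, A\<^sub>1, A\<^sub>2, M) =
     list_encode [n, zmax_mat_code A\<^sub>1, zmax_mat_code A\<^sub>2, zmax_mat_code M]"

lemma inj_zmax_code: "inj zmax_code"
proof (rule injI)
  fix x y show "zmax_code x = zmax_code y \<Longrightarrow> x = y"
    by (cases x; cases y) (auto simp: int_encode_eq)
qed

lemma zmax_mat_code_inj:
  assumes "A \<in> carrier_mat n n" "B \<in> carrier_mat n n" and "zmax_mat_code A = zmax_mat_code B"
  shows "A = B"
proof -
  have "inj (list_encode \<circ> map zmax_code)"
    by (intro inj_compose inj_list_encode inj_mapI inj_zmax_code)
  then have eq: "mat_to_list A = mat_to_list B"
    using assms(3) by (simp add: zmax_mat_code_def list_encode_eq)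
  show ?thesis
  proof (rule eq_matI)
    fix i j assume "i < dim_row B" "j < dim_col B"
    then have "i < n" "j < n" using assms(2) by auto
    then have "mat_to_list A ! i ! j = A $$ (i, j)" "mat_to_list B ! i ! j = B $$ (i, j)"
      using assms(1,2) by (auto simp: mat_to_list_def)
    with eq show "A $$ (i, j) = B $$ (i, j)" by simp
  qed (use assms in auto)
qed

lemma inj_on_instance_code: "inj_on instance_code zmax_instances"
proof (rule inj_onI)
  fix x y assume xy: "x \<in> zmax_instances" "y \<in> zmax_instances" "instance_code x = instance_code y"
  obtain n A\<^sub>1 A\<^sub>2 M where x: "x = (n, A\<^sub>1, A\<^sub>2, M)" by (cases x)
  obtain n' B\<^sub>1 B\<^sub>2 N where y: "y = (n', B\<^sub>1, B\<^sub>2, N)" by (cases y)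
  have eq: "n = n'" "zmax_mat_code A\<^sub>1 = zmax_mat_code B\<^sub>1" "zmax_mat_code A\<^sub>2 = zmax_mat_code B\<^sub>2"
    "zmax_mat_code M = zmax_mat_code N"
    using xy(3) unfolding x y instance_code.simps list_encode_eq by simp_all
  have "A\<^sub>1 \<in> carrier_mat n n" "A\<^sub>2 \<in> carrier_mat n n" "M \<in> carrier_mat n n"
    "B\<^sub>1 \<in> carrier_mat n n" "B\<^sub>2 \<in> carrier_mat n n" "N \<in> carrier_mat n n"
    using xy(1,2) eq(1) by (simp_all add: zmax_instances_def x y)
  with eq show "x = y"
    unfolding x y by (simp add: zmax_mat_code_inj)
qed

end

theory Submission
  imports Defs
begin

text \<open>
  The proof is a diagonal argument resting on a reduction: for every partial recursive function
  \<open>f\<close> and every input \<open>x\<close> there are two max-plus matrices and a target such that some product of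
  the two is proportional to the target iff \<open>f x = 0\<close>.

  \<^bold>\<open>From functions to register machines.\<close> Reachability is existential, so nondeterministic
  programs suffice: relations on register stores built from copying, incrementing, decrementing
  and testing for zero by composition and iteration (\<open>implementable_relcomp\<close>,
  \<open>implementable_rtrancl\<close>). Each of Kleene's schemes is such a program; a wrong guess of the
  number of iterations ends in a failing test. This gives \<open>transition_system_for_recfun\<close>: a finite
  transition system that leads from the store holding \<open>x\<close> to the zero store iff \<open>f x = 0\<close>.

  \<^bold>\<open>From register machines to max-plus letters.\<close> A configuration is a row vector of finite entries
  holding a reference value \<open>0\<close>, an error value, and both \<open>v\<close> and \<open>- v\<close> for each register and for
  the control state. Every transition, executed whether or not it is enabled, is a max-plus linear
  map: assignments of the form \<open>v := v' + c\<close> take one finite entry per column, and a test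
  \<open>v + c \<le> 0\<close> is performed by adding (in the max-plus sense) \<open>v + c\<close> to the error value, which
  therefore stays \<open>0\<close> as long as all tests succeed and is positive ever after one has failed.
  A word of transitions is a run iff the error value at its end is \<open>0\<close>. One more letter, the
  reset, has a single row different from \<open>-\<infinity>\<close> and replaces any vector with reference value \<open>0\<close> by
  the initial configuration. It turns reachability of a vector into reachability of a matrix: once
  all rows have undergone a reset, each of them is \<open>-\<infinity>\<close> or the vector reached since the last reset;
  before, an error value stays finite in some row where the target is \<open>-\<infinity>\<close>.
  Since the reference entry is \<open>0\<close> both in the products and in the target, proportionality amounts
  to equality.

  \<^bold>\<open>From many letters to two matrices.\<close> With one block of coordinates for each letter, one matrix
  shifts the blocks cyclically, and the other applies to each block its own letter and moves the
  result to the first block. The outcome of these reductions is \<open>product_proportional_iff\<close>.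

  \<^bold>\<open>The diagonal.\<close> The input \<open>x\<close> occurs in just two entries of the second matrix, in its first
  row, so the code of the instance for \<open>f\<close> and \<open>x\<close> is a simple recursive function of \<open>x\<close> and five
  numbers depending on \<open>f\<close>. Let \<open>c\<close> be a code of these five numbers; a recursive function
  \<open>self_assemble\<close>, the same for all \<open>f\<close>, maps \<open>c\<close> to the code of the instance for \<open>f\<close> and the input
  \<open>c\<close>. If \<open>d\<close> decides the problem and \<open>f\<close> is \<open>d\<close> after \<open>self_assemble\<close>, then \<open>f c\<close> is \<open>1\<close> if the
  instance is positive, that is if \<open>f c = 0\<close>, and it is \<open>0\<close> otherwise. So \<open>f\<close> is numbered by the
  matrices of its own reduction.
\<close>

section \<open>Finite transition systems on register stores\<close>

type_synonym store = "nat \<Rightarrow> nat"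

datatype op = Copy nat nat | Inc nat | Dec nat | Tst nat

fun opsem :: "op \<Rightarrow> store rel" where
  "opsem (Copy i j) = {(\<sigma>, \<tau>). \<tau> = \<sigma>(i := \<sigma> j)}"
| "opsem (Inc i) = {(\<sigma>, \<tau>). \<tau> = \<sigma>(i := Suc (\<sigma> i))}"
| "opsem (Dec i) = {(\<sigma>, \<tau>). \<sigma> i \<noteq> 0 \<and> \<tau> = \<sigma>(i := \<sigma> i - 1)}"
| "opsem (Tst i) = {(\<sigma>, \<tau>). \<sigma> i = 0 \<and> \<tau> = \<sigma>}"

type_synonym transition = "nat list \<times> op \<times> nat list"

definition step :: "transition set \<Rightarrow> (nat list \<times> store) rel" where
  "step T = {((p, \<sigma>), (q, \<tau>)). \<exists>a. (p, a, q) \<in> T \<and> (\<sigma>, \<tau>) \<in> opsem a}"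

text \<open>
  Control states are lists so that the systems for two subprograms are made disjoint by prefixing
  a tag to their states; \<open>[0]\<close> is the initial and \<open>[1]\<close> the final state. Nonemptiness provides a
  letter other than the reset in the matrix encoding.
\<close>

definition implementable :: "store rel \<Rightarrow> bool" where
  "implementable R \<longleftrightarrow> (\<exists>T. finite T \<and> T \<noteq> {} \<and>
     (\<forall>\<sigma> \<tau>. (\<sigma>, \<tau>) \<in> R \<longleftrightarrow> (([0], \<sigma>), ([1], \<tau>)) \<in> (step T)\<^sup>*))"

lemma stepI: "(p, a, q) \<in> T \<Longrightarrow> (\<sigma>, \<tau>) \<in> opsem a \<Longrightarrow> ((p, \<sigma>), (q, \<tau>)) \<in> step T"
  unfolding step_def by blast

lemma step_invariant:
  assumes "((p, \<sigma>), (q, \<tau>)) \<in> (step T)\<^sup>*" and "I p \<sigma>"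
    and "\<And>p a q \<sigma> \<tau>. (p, a, q) \<in> T \<Longrightarrow> (\<sigma>, \<tau>) \<in> opsem a \<Longrightarrow> I p \<sigma> \<Longrightarrow> I q \<tau>"
  shows "I q \<tau>"
  using assms(1)
proof (induction rule: rtrancl_induct2)
  case refl
  show ?case by fact
next
  case (step q \<tau> q' \<tau>')
  then show ?case using assms(3) unfolding step_def by blast
qed

lemma implementable_op: "implementable (opsem a)"
proof -
  let ?T = "{([0], a, [1])}"
  have "(\<sigma>, \<tau>) \<in> opsem a \<longleftrightarrow> (([0], \<sigma>), ([1], \<tau>)) \<in> (step ?T)\<^sup>*" for \<sigma> \<tau>
  proof
    assume "(\<sigma>, \<tau>) \<in> opsem a"
    then show "(([0], \<sigma>), ([1], \<tau>)) \<in> (step ?T)\<^sup>*"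
      by (intro r_into_rtrancl stepI[of _ a]) simp_all
  next
    assume "(([0], \<sigma>), ([1], \<tau>)) \<in> (step ?T)\<^sup>*"
    from step_invariant[OF this, of "\<lambda>p \<rho>. p = [0] \<and> \<rho> = \<sigma> \<or> p = [1] \<and> (\<sigma>, \<rho>) \<in> opsem a"]
    show "(\<sigma>, \<tau>) \<in> opsem a" by auto
  qed
  then show ?thesis unfolding implementable_def by blast
qed

abbreviation "skip \<equiv> Copy 0 0"

lemma opsem_skip [simp]: "(\<sigma>, \<tau>) \<in> opsem skip \<longleftrightarrow> \<tau> = \<sigma>"
  by simp

lemma opsem_iff:
  "(\<sigma>, \<tau>) \<in> opsem (Copy i j) \<longleftrightarrow> \<tau> = \<sigma>(i := \<sigma> j)"
  "(\<sigma>, \<tau>) \<in> opsem (Inc i) \<longleftrightarrow> \<tau> = \<sigma>(i := Suc (\<sigma> i))"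
  "(\<sigma>, \<tau>) \<in> opsem (Dec i) \<longleftrightarrow> \<sigma> i \<noteq> 0 \<and> \<tau> = \<sigma>(i := \<sigma> i - 1)"
  "(\<sigma>, \<tau>) \<in> opsem (Tst i) \<longleftrightarrow> \<sigma> i = 0 \<and> \<tau> = \<sigma>"
  by simp_all

declare opsem.simps [simp del]

lemma implementable_empty: "implementable {}"
proof -
  let ?T = "{([0], skip, [0])}"
  have "(([0], \<sigma>), ([1], \<tau>)) \<notin> (step ?T)\<^sup>*" for \<sigma> \<tau>
    using step_invariant[of "[0]" \<sigma> "[1]" \<tau> ?T "\<lambda>p \<rho>. p = [0]"] by auto
  then show ?thesis unfolding implementable_def by blast
qed

definition tag :: "nat \<Rightarrow> transition set \<Rightarrow> transition set" where
  "tag t T = (\<lambda>(p, a, q). (t # p, a, t # q)) ` T"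

lemma finite_tag: "finite T \<Longrightarrow> finite (tag t T)"
  by (simp add: tag_def)

lemma mem_tag: "(p', a, q') \<in> tag t T \<longleftrightarrow> (\<exists>p q. p' = t # p \<and> q' = t # q \<and> (p, a, q) \<in> T)"
  by (force simp: tag_def)

lemma step_tag:
  assumes "((p, \<sigma>), (q, \<tau>)) \<in> (step T)\<^sup>*" and "tag t T \<subseteq> U"
  shows "((t # p, \<sigma>), (t # q, \<tau>)) \<in> (step U)\<^sup>*"
  using assms(1)
proof (induction rule: rtrancl_induct2)
  case refl
  show ?case by simp
next
  case (step q \<tau> q' \<tau>')
  from step(2) obtain a where "(q, a, q') \<in> T" "(\<tau>, \<tau>') \<in> opsem a"
    unfolding step_def by blast
  then have "((t # q, \<tau>), (t # q', \<tau>')) \<in> step U"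
    using assms(2) by (intro stepI[of _ a]) (auto simp: mem_tag)
  with step(3) show ?case by (rule rtrancl_into_rtrancl)
qed

lemma skip_then:
  assumes "(p, skip, q) \<in> T" and "((q, \<sigma>), c) \<in> (step T)\<^sup>*"
  shows "((p, \<sigma>), c) \<in> (step T)\<^sup>*"
  by (rule converse_rtrancl_into_rtrancl[OF _ assms(2)]) (rule stepI[OF assms(1)], simp)

text \<open>
  The new states are the tagged states of both systems. The invariant of the converse direction
  says, for each kind of state, which prefix of the composed computation has been carried out.
\<close>

lemma implementable_relcomp:
  assumes "implementable R" "implementable S"
  shows "implementable (R O S)"
proof -
  obtain T where T: "finite T" "\<And>\<sigma> \<tau>. (\<sigma>, \<tau>) \<in> R \<longleftrightarrow> (([0], \<sigma>), ([1], \<tau>)) \<in> (step T)\<^sup>*"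
    using assms(1) unfolding implementable_def by blast
  obtain U where U: "finite U" "\<And>\<sigma> \<tau>. (\<sigma>, \<tau>) \<in> S \<longleftrightarrow> (([0], \<sigma>), ([1], \<tau>)) \<in> (step U)\<^sup>*"
    using assms(2) unfolding implementable_def by blast
  define V where "V = tag 2 T \<union> tag 3 U \<union>
    {([0], skip, [2, 0]), ([2, 1], skip, [3, 0]), ([3, 1], skip, [1])}"
  have "(\<sigma>, \<tau>) \<in> R O S \<longleftrightarrow> (([0], \<sigma>), ([1], \<tau>)) \<in> (step V)\<^sup>*" for \<sigma> \<tau>
  proof
    assume "(\<sigma>, \<tau>) \<in> R O S"
    then obtain \<rho> where "(([0], \<sigma>), ([1], \<rho>)) \<in> (step T)\<^sup>*" "(([0], \<rho>), ([1], \<tau>)) \<in> (step U)\<^sup>*"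
      unfolding T(2)[symmetric] U(2)[symmetric] by blast
    then have "(([2, 0], \<sigma>), ([2, 1], \<rho>)) \<in> (step V)\<^sup>*" "(([3, 0], \<rho>), ([3, 1], \<tau>)) \<in> (step V)\<^sup>*"
      by (auto intro!: step_tag simp: V_def)
    moreover have "(([3, 1], \<tau>), ([1], \<tau>)) \<in> (step V)\<^sup>*"
      by (rule skip_then[where q = "[1]"]) (auto simp: V_def)
    ultimately have "(([3, 0], \<rho>), ([1], \<tau>)) \<in> (step V)\<^sup>*" by (rule_tac rtrancl_trans)
    then have "(([2, 1], \<rho>), ([1], \<tau>)) \<in> (step V)\<^sup>*"
      by (rule skip_then[rotated]) (auto simp: V_def)
    with \<open>(([2, 0], \<sigma>), ([2, 1], \<rho>)) \<in> (step V)\<^sup>*\<close>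
    have "(([2, 0], \<sigma>), ([1], \<tau>)) \<in> (step V)\<^sup>*" by (rule rtrancl_trans)
    then show "(([0], \<sigma>), ([1], \<tau>)) \<in> (step V)\<^sup>*"
      by (rule skip_then[rotated]) (auto simp: V_def)
  next
    let ?I = "\<lambda>s \<tau>. (s = [0] \<and> \<tau> = \<sigma>) \<or>
      (\<exists>p. s = 2 # p \<and> (([0], \<sigma>), (p, \<tau>)) \<in> (step T)\<^sup>*) \<or>
      (\<exists>p \<rho>. s = 3 # p \<and> (\<sigma>, \<rho>) \<in> R \<and> (([0], \<rho>), (p, \<tau>)) \<in> (step U)\<^sup>*) \<or>
      (s = [1] \<and> (\<sigma>, \<tau>) \<in> R O S)"
    assume "(([0], \<sigma>), ([1], \<tau>)) \<in> (step V)\<^sup>*"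
    then have "?I [1] \<tau>"
    proof (rule step_invariant[where I = ?I])
      fix p a q \<sigma>' \<tau>'
      assume "(p, a, q) \<in> V" and a: "(\<sigma>', \<tau>') \<in> opsem a" and I: "?I p \<sigma>'"
      then consider "(p, a, q) \<in> tag 2 T" | "(p, a, q) \<in> tag 3 U" | "p = [0]" "a = skip" "q = [2, 0]"
        | "p = [2, 1]" "a = skip" "q = [3, 0]" | "p = [3, 1]" "a = skip" "q = [1]"
        unfolding V_def by auto
      then show "?I q \<tau>'"
      proof cases
        case 1
        then obtain p' q' where pq: "p = 2 # p'" "q = 2 # q'" "(p', a, q') \<in> T"
          by (auto simp: mem_tag)
        with I have "(([0], \<sigma>), (p', \<sigma>')) \<in> (step T)\<^sup>*" by auto
        also have "((p', \<sigma>'), (q', \<tau>')) \<in> step T" using pq(3) a by (rule stepI)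
        finally show ?thesis using pq by simp
      next
        case 2
        then obtain p' q' where pq: "p = 3 # p'" "q = 3 # q'" "(p', a, q') \<in> U"
          by (auto simp: mem_tag)
        with I obtain \<rho> where \<rho>: "(\<sigma>, \<rho>) \<in> R" "(([0], \<rho>), (p', \<sigma>')) \<in> (step U)\<^sup>*" by auto
        note \<rho>(2)
        also have "((p', \<sigma>'), (q', \<tau>')) \<in> step U" using pq(3) a by (rule stepI)
        finally show ?thesis using pq \<rho>(1) by auto
      next
        case 3
        with I a show ?thesis by simp
      next
        case 4
        with I a show ?thesis by (auto simp: T(2))
      next
        case 5
        with I a show ?thesis by (auto simp: U(2))
      qed
    qed simp
    then show "(\<sigma>, \<tau>) \<in> R O S" by simp
  qed
  moreover have "finite V" "V \<noteq> {}"
    using T(1) U(1) by (simp_all add: V_def finite_tag)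
  ultimately show ?thesis unfolding implementable_def by blast
qed

text \<open>
  The loop may be left at its head at any time. How often it has to be iterated is settled by a
  test that follows it in the program.
\<close>

lemma implementable_rtrancl:
  assumes "implementable R"
  shows "implementable (R\<^sup>*)"
proof -
  obtain T where T: "finite T" "\<And>\<sigma> \<tau>. (\<sigma>, \<tau>) \<in> R \<longleftrightarrow> (([0], \<sigma>), ([1], \<tau>)) \<in> (step T)\<^sup>*"
    using assms(1) unfolding implementable_def by blast
  define V where "V = tag 2 T \<union>
    {([0], skip, [2, 0]), ([2, 1], skip, [0]), ([0], skip, [1])}"
  have "(\<sigma>, \<tau>) \<in> R\<^sup>* \<longleftrightarrow> (([0], \<sigma>), ([1], \<tau>)) \<in> (step V)\<^sup>*" for \<sigma> \<tau>
  proof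
    assume "(\<sigma>, \<tau>) \<in> R\<^sup>*"
    then show "(([0], \<sigma>), ([1], \<tau>)) \<in> (step V)\<^sup>*"
    proof (induction rule: converse_rtrancl_induct)
      case base
      show ?case by (rule skip_then[where q = "[1]"]) (auto simp: V_def)
    next
      case (step \<sigma> \<rho>)
      then have "(([2, 0], \<sigma>), ([2, 1], \<rho>)) \<in> (step V)\<^sup>*"
        by (auto intro!: step_tag simp: V_def T(2))
      moreover have "(([2, 1], \<rho>), ([1], \<tau>)) \<in> (step V)\<^sup>*"
        using step(3) by (rule skip_then[rotated]) (auto simp: V_def)
      ultimately have "(([2, 0], \<sigma>), ([1], \<tau>)) \<in> (step V)\<^sup>*" by (rule rtrancl_trans)
      then show ?case
        by (rule skip_then[rotated]) (auto simp: V_def)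
    qed
  next
    let ?I = "\<lambda>s \<tau>. ((s = [0] \<or> s = [1]) \<and> (\<sigma>, \<tau>) \<in> R\<^sup>*) \<or>
      (\<exists>p \<rho>. s = 2 # p \<and> (\<sigma>, \<rho>) \<in> R\<^sup>* \<and> (([0], \<rho>), (p, \<tau>)) \<in> (step T)\<^sup>*)"
    assume "(([0], \<sigma>), ([1], \<tau>)) \<in> (step V)\<^sup>*"
    then have "?I [1] \<tau>"
    proof (rule step_invariant[where I = ?I])
      fix p a q \<sigma>' \<tau>'
      assume "(p, a, q) \<in> V" and a: "(\<sigma>', \<tau>') \<in> opsem a" and I: "?I p \<sigma>'"
      then consider "(p, a, q) \<in> tag 2 T" | "p = [0]" "a = skip" "q = [2, 0]"
        | "p = [2, 1]" "a = skip" "q = [0]" | "p = [0]" "a = skip" "q = [1]"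
        unfolding V_def by auto
      then show "?I q \<tau>'"
      proof cases
        case 1
        then obtain p' q' where pq: "p = 2 # p'" "q = 2 # q'" "(p', a, q') \<in> T"
          by (auto simp: mem_tag)
        with I obtain \<rho> where \<rho>: "(\<sigma>, \<rho>) \<in> R\<^sup>*" "(([0], \<rho>), (p', \<sigma>')) \<in> (step T)\<^sup>*" by auto
        note \<rho>(2)
        also have "((p', \<sigma>'), (q', \<tau>')) \<in> step T" using pq(3) a by (rule stepI)
        finally show ?thesis using pq \<rho>(1) by auto
      next
        case 2
        with I a show ?thesis by auto
      next
        case 3
        with I a obtain \<rho> where "(\<sigma>, \<rho>) \<in> R\<^sup>*" "(\<rho>, \<tau>') \<in> R" by (auto simp: T(2))
        then have "(\<sigma>, \<tau>') \<in> R\<^sup>*" by (rule rtrancl_into_rtrancl)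
        with 3 show ?thesis by simp
      next
        case 4
        with I a show ?thesis by auto
      qed
    qed simp
    then show "(\<sigma>, \<tau>) \<in> R\<^sup>*" by simp
  qed
  moreover have "finite V" "V \<noteq> {}"
    using T(1) by (simp_all add: V_def finite_tag)
  ultimately show ?thesis unfolding implementable_def by blast
qed

section \<open>Partial recursive functions are implementable\<close>

lemma relcomp_iff: "(\<sigma>, \<tau>) \<in> R O S \<longleftrightarrow> (\<exists>\<rho>. (\<sigma>, \<rho>) \<in> R \<and> (\<rho>, \<tau>) \<in> S)"
  by auto

definition clear :: "nat \<Rightarrow> store rel" where
  "clear i = {(\<sigma>, \<tau>). \<tau> = \<sigma>(i := 0)}"

lemma clear_iff: "(\<sigma>, \<tau>) \<in> clear i \<longleftrightarrow> \<tau> = \<sigma>(i := 0)"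
  by (simp add: clear_def)

lemma implementable_clear: "implementable (clear i)"
proof -
  have dec: "(\<sigma>, \<sigma>(i := n)) \<in> (opsem (Dec i))\<^sup>*" if "n \<le> \<sigma> i" for n \<sigma>
    using that
  proof (induction rule: inc_induct)
    case base
    show ?case by simp
  next
    case (step n)
    have "(\<sigma>(i := Suc n), \<sigma>(i := n)) \<in> opsem (Dec i)" by (simp add: opsem_iff)
    with step(3) show ?case by (rule rtrancl_into_rtrancl)
  qed
  have "(opsem (Dec i))\<^sup>* O opsem (Tst i) = clear i"
  proof (intro equalityI subrelI)
    fix \<sigma> \<tau> assume "(\<sigma>, \<tau>) \<in> (opsem (Dec i))\<^sup>* O opsem (Tst i)"
    then have "(\<sigma>, \<tau>) \<in> (opsem (Dec i))\<^sup>*" "\<tau> i = 0" by (auto simp: opsem_iff)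
    moreover from this(1) have "\<exists>n. \<tau> = \<sigma>(i := n)"
    proof (induction rule: rtrancl_induct)
      case base
      show ?case by (metis fun_upd_triv)
    qed (auto simp: opsem_iff simp del: fun_upd_apply)
    ultimately show "(\<sigma>, \<tau>) \<in> clear i" by (auto simp: clear_iff)
  next
    fix \<sigma> \<tau> assume "(\<sigma>, \<tau>) \<in> clear i"
    then show "(\<sigma>, \<tau>) \<in> (opsem (Dec i))\<^sup>* O opsem (Tst i)"
      using dec[of 0 \<sigma>] by (auto simp: clear_iff opsem_iff intro!: relcompI)
  qed
  then show ?thesis
    using implementable_relcomp implementable_rtrancl implementable_op by metis
qed

text \<open>
  Registers from \<open>b\<close> on are free for temporary values. A program may rely on their being zero and
  has to leave them so; this makes the effect of a subprogram on the store exactly one assignment.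
\<close>

definition clean :: "nat \<Rightarrow> store \<Rightarrow> bool" where
  "clean b \<sigma> \<longleftrightarrow> (\<forall>i\<ge>b. \<sigma> i = 0)"

text \<open>
  The program stores the value of \<open>f\<close> at the contents of the registers \<open>args\<close> in the register \<open>d\<close>.
  It has no terminating run if this value is undefined.
\<close>

definition evaluates :: "recfun \<Rightarrow> nat list \<Rightarrow> nat \<Rightarrow> nat \<Rightarrow> store rel \<Rightarrow> bool" where
  "evaluates f args d b R \<longleftrightarrow> implementable R \<and> (\<forall>\<sigma> \<tau>. clean b \<sigma> \<longrightarrow>
     ((\<sigma>, \<tau>) \<in> R \<longleftrightarrow> (\<exists>y. rec_eval f (map \<sigma> args) y \<and> \<tau> = \<sigma>(d := y))))"

definition evaluable :: "recfun \<Rightarrow> bool" where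
  "evaluable f \<longleftrightarrow> (\<forall>args d b. set args \<subseteq> {..<b} \<longrightarrow> d < b \<longrightarrow> (\<exists>R. evaluates f args d b R))"

lemma evaluableI:
  "(\<And>args d b. set args \<subseteq> {..<b} \<Longrightarrow> d < b \<Longrightarrow> \<exists>R. evaluates f args d b R) \<Longrightarrow> evaluable f"
  unfolding evaluable_def by blast

lemma evaluableE:
  assumes "evaluable f" "set args \<subseteq> {..<b}" "d < b"
  obtains R where "implementable R" and "\<And>\<sigma> \<tau>. clean b \<sigma> \<Longrightarrow>
     (\<sigma>, \<tau>) \<in> R \<longleftrightarrow> (\<exists>y. rec_eval f (map \<sigma> args) y \<and> \<tau> = \<sigma>(d := y))"
  using assms unfolding evaluable_def evaluates_def by blast

lemma map_fun_upd_outside: "x \<notin> set xs \<Longrightarrow> map (\<sigma>(x := y)) xs = map \<sigma> xs"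
  by (rule map_cong) auto

text \<open>
  This covers terms applied to a wrong number of arguments.
\<close>

lemma evaluates_empty:
  "(\<And>\<sigma> y. \<not> rec_eval f (map \<sigma> args) y) \<Longrightarrow> \<exists>R. evaluates f args d b R"
  by (rule exI[of _ "{}"]) (simp add: evaluates_def implementable_empty)

lemma evaluable_RZero: "evaluable RZero"
proof (rule evaluableI)
  fix args d b
  have "rec_eval RZero xs y \<longleftrightarrow> y = 0" for xs y
    by (auto intro: rec_eval.zero elim: rec_eval_RZeroE)
  then show "\<exists>R. evaluates RZero args d b R"
    by (intro exI[of _ "clear d"]) (auto simp: evaluates_def implementable_clear clear_iff)
qed

lemma evaluable_RSucc: "evaluable RSucc"
proof (rule evaluableI)
  fix args :: "nat list" and d b
  show "\<exists>R. evaluates RSucc args d b R"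
  proof (cases "\<exists>a. args = [a]")
    case True
    then obtain a where "args = [a]" by blast
    moreover have "rec_eval RSucc [x] y \<longleftrightarrow> y = Suc x" for x y
      by (auto intro: rec_eval.succ elim: rec_eval_RSuccE)
    ultimately show ?thesis
      by (intro exI[of _ "opsem (Copy d a) O opsem (Inc d)"])
        (auto simp: evaluates_def relcomp_iff opsem_iff intro!: implementable_relcomp implementable_op)
  next
    case False
    then show ?thesis
      by (intro evaluates_empty) (auto elim!: rec_eval_RSuccE)
  qed
qed

lemma evaluable_RProj: "evaluable (RProj i)"
proof (rule evaluableI)
  fix args :: "nat list" and d b
  have "rec_eval (RProj i) xs y \<longleftrightarrow> i < length xs \<and> y = xs ! i" for xs y
    by (auto intro: rec_eval.proj elim: rec_eval_RProjE)
  then show "\<exists>R. evaluates (RProj i) args d b R"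
    by (intro exI[of _ "if i < length args then opsem (Copy d (args ! i)) else {}"])
      (auto simp: evaluates_def opsem_iff(1) implementable_op implementable_empty)
qed

fun put :: "nat \<Rightarrow> nat list \<Rightarrow> store \<Rightarrow> store" where
  "put c [] \<sigma> = \<sigma>"
| "put c (y # ys) \<sigma> = put (Suc c) ys (\<sigma>(c := y))"

lemma put_outside: "i < c \<or> c + length ys \<le> i \<Longrightarrow> put c ys \<sigma> i = \<sigma> i"
  by (induction ys arbitrary: c \<sigma>) auto

lemma put_inside: "i < length ys \<Longrightarrow> put c ys \<sigma> (c + i) = ys ! i"
proof (induction ys arbitrary: c \<sigma> i)
  case (Cons y ys)
  then show ?case
    using put_outside[of c "Suc c" ys] Cons.IH[of _ "Suc c"] by (cases i) auto
qed simp

lemma implementable_eval_list: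
  assumes "\<forall>g\<in>set gs. evaluable g" "set args \<subseteq> {..<c}" "c + length gs \<le> b"
  shows "\<exists>R. implementable R \<and> (\<forall>\<sigma> \<tau>. clean b \<sigma> \<longrightarrow> ((\<sigma>, \<tau>) \<in> R \<longleftrightarrow>
    (\<exists>ys. list_all2 (\<lambda>g y. rec_eval g (map \<sigma> args) y) gs ys \<and> \<tau> = put c ys \<sigma>)))"
  using assms
proof (induction gs arbitrary: c)
  case Nil
  have "(\<sigma>, \<tau>) \<in> opsem skip \<longleftrightarrow> \<tau> = \<sigma>" for \<sigma> \<tau> by simp
  then show ?case by (auto intro!: exI[of _ "opsem skip"] implementable_op)
next
  case (Cons g gs)
  from Cons.prems have "set args \<subseteq> {..<b}" "c < b" by auto
  with Cons.prems(1) obtain R where R: "implementable R"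
    "\<And>\<sigma> \<tau>. clean b \<sigma> \<Longrightarrow>
      (\<sigma>, \<tau>) \<in> R \<longleftrightarrow> (\<exists>y. rec_eval g (map \<sigma> args) y \<and> \<tau> = \<sigma>(c := y))"
    by (auto elim: evaluableE)
  have "set args \<subseteq> {..<Suc c}" using Cons.prems(2) by auto
  with Cons obtain S where S: "implementable S"
    "\<And>\<sigma> \<tau>. clean b \<sigma> \<Longrightarrow> (\<sigma>, \<tau>) \<in> S \<longleftrightarrow>
      (\<exists>ys. list_all2 (\<lambda>g y. rec_eval g (map \<sigma> args) y) gs ys \<and> \<tau> = put (Suc c) ys \<sigma>)"
    by (metis add_Suc_shift length_Cons list.set_intros(2))
  have "(\<sigma>, \<tau>) \<in> R O S \<longleftrightarrow>
      (\<exists>ys. list_all2 (\<lambda>g y. rec_eval g (map \<sigma> args) y) (g # gs) ys \<and> \<tau> = put c ys \<sigma>)"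
    if "clean b \<sigma>" for \<sigma> \<tau>
  proof -
    have clean: "clean b (\<sigma>(c := y))" for y
      using that \<open>c < b\<close> by (auto simp: clean_def)
    have args: "map (\<sigma>(c := y)) args = map \<sigma> args" for y
      using Cons.prems(2) by (intro map_fun_upd_outside) auto
    have "(\<sigma>(c := y), \<tau>) \<in> S \<longleftrightarrow>
        (\<exists>ys. list_all2 (\<lambda>g y. rec_eval g (map \<sigma> args) y) gs ys \<and> \<tau> = put c (y # ys) \<sigma>)" for y
      unfolding S(2)[OF clean] args put.simps ..
    moreover have "(\<sigma>, \<tau>) \<in> R O S \<longleftrightarrow> (\<exists>y. rec_eval g (map \<sigma> args) y \<and> (\<sigma>(c := y), \<tau>) \<in> S)"
      unfolding relcomp_iff R(2)[OF that] by blast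
    ultimately show ?thesis
      unfolding list_all2_Cons1 by blast
  qed
  then show ?case
    using implementable_relcomp[OF R(1) S(1)] by blast
qed

definition clear_range :: "nat \<Rightarrow> nat \<Rightarrow> store \<Rightarrow> store" where
  "clear_range b m \<sigma> = (\<lambda>i. if b \<le> i \<and> i < b + m then 0 else \<sigma> i)"

lemma implementable_clear_range: "implementable {(\<sigma>, \<tau>). \<tau> = clear_range b m \<sigma>}"
proof (induction m)
  case 0
  have "clear_range b 0 \<sigma> = \<sigma>" for \<sigma>
    by (auto simp: clear_range_def fun_eq_iff)
  then have "{(\<sigma>, \<tau>). \<tau> = clear_range b 0 \<sigma>} = opsem skip"
    by (simp add: opsem.simps)
  then show ?case using implementable_op by simp
next
  case (Suc m)
  have "clear_range b (Suc m) \<sigma> = (clear_range b m \<sigma>)(b + m := 0)" for \<sigma>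
    by (auto simp: clear_range_def fun_eq_iff)
  then have "(\<sigma>, \<tau>) \<in> {(\<sigma>, \<tau>). \<tau> = clear_range b m \<sigma>} O clear (b + m) \<longleftrightarrow>
      \<tau> = clear_range b (Suc m) \<sigma>" for \<sigma> \<tau>
    unfolding relcomp_iff clear_iff by simp
  then have eq: "{(\<sigma>, \<tau>). \<tau> = clear_range b m \<sigma>} O clear (b + m) =
      {(\<sigma>, \<tau>). \<tau> = clear_range b (Suc m) \<sigma>}"
    by auto
  show ?case
    unfolding eq[symmetric] by (rule implementable_relcomp[OF Suc implementable_clear])
qed

text \<open>
  The values of the inner functions go to the registers from \<open>b\<close> on, which become the arguments of
  the outer function and are cleared at the end.
\<close>

lemma evaluable_RComp:
  assumes "evaluable f" "\<forall>g\<in>set gs. evaluable g"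
  shows "evaluable (RComp f gs)"
proof (rule evaluableI)
  fix args :: "nat list" and d b :: nat
  assume args: "set args \<subseteq> {..<b}" and d: "d < b"
  define b' where "b' = b + length gs"
  obtain R where R: "implementable R"
    "\<And>\<sigma> \<tau>. clean b' \<sigma> \<Longrightarrow> (\<sigma>, \<tau>) \<in> R \<longleftrightarrow>
      (\<exists>ys. list_all2 (\<lambda>g y. rec_eval g (map \<sigma> args) y) gs ys \<and> \<tau> = put b ys \<sigma>)"
    using implementable_eval_list[OF assms(2) args, of b'] unfolding b'_def by blast
  obtain S where S: "implementable S"
    "\<And>\<sigma> \<tau>. clean b' \<sigma> \<Longrightarrow>
      (\<sigma>, \<tau>) \<in> S \<longleftrightarrow> (\<exists>y. rec_eval f (map \<sigma> [b..<b']) y \<and> \<tau> = \<sigma>(d := y))"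
    using d by (rule_tac evaluableE[OF assms(1), of "[b..<b']" b' d]) (auto simp: b'_def)
  define C :: "store rel"
    where "C = {(\<sigma>, \<tau>). \<tau> = clear_range b (length gs) \<sigma>}"
  have "(\<sigma>, \<tau>) \<in> R O S O C \<longleftrightarrow> (\<exists>y. rec_eval (RComp f gs) (map \<sigma> args) y \<and> \<tau> = \<sigma>(d := y))"
    if \<sigma>: "clean b \<sigma>" for \<sigma> \<tau>
  proof -
    have \<sigma>': "clean b' \<sigma>" using \<sigma> by (auto simp: clean_def b'_def)
    have put: "(put b ys \<sigma>, \<tau>) \<in> S O C \<longleftrightarrow> (\<exists>y. rec_eval f ys y \<and> \<tau> = \<sigma>(d := y))"
      if "length ys = length gs" for ys
    proof -
      have "clean b' (put b ys \<sigma>)"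
        using \<sigma> that by (auto simp: clean_def b'_def put_outside)
      moreover have "map (put b ys \<sigma>) [b..<b'] = ys"
        using that by (intro nth_equalityI) (auto simp: b'_def put_inside)
      moreover have "((put b ys \<sigma>)(d := y), \<tau>) \<in> C \<longleftrightarrow> \<tau> = \<sigma>(d := y)" for y
      proof -
        have "clear_range b (length gs) ((put b ys \<sigma>)(d := y)) = \<sigma>(d := y)"
          using \<sigma> d that by (auto simp: clear_range_def clean_def fun_eq_iff put_outside)
        then show ?thesis by (simp add: C_def)
      qed
      ultimately show ?thesis by (auto simp: relcomp_iff S(2))
    qed
    show ?thesis
    proof
      assume "(\<sigma>, \<tau>) \<in> R O S O C"
      then obtain ys where ys: "list_all2 (\<lambda>g y. rec_eval g (map \<sigma> args) y) gs ys"
        and "(put b ys \<sigma>, \<tau>) \<in> S O C"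
        unfolding relcomp_iff[of \<sigma> \<tau> R] R(2)[OF \<sigma>'] by blast
      then show "\<exists>y. rec_eval (RComp f gs) (map \<sigma> args) y \<and> \<tau> = \<sigma>(d := y)"
        using put[of ys] list_all2_lengthD[OF ys] rec_eval.comp[OF ys] by auto
    next
      assume "\<exists>y. rec_eval (RComp f gs) (map \<sigma> args) y \<and> \<tau> = \<sigma>(d := y)"
      then obtain y ys where ys: "list_all2 (\<lambda>g y. rec_eval g (map \<sigma> args) y) gs ys"
        and y: "rec_eval f ys y" "\<tau> = \<sigma>(d := y)"
        by (auto elim: rec_eval_RCompE)
      then have "(put b ys \<sigma>, \<tau>) \<in> S O C"
        using put[of ys] list_all2_lengthD[OF ys] by auto
      moreover have "(\<sigma>, put b ys \<sigma>) \<in> R" using ys R(2)[OF \<sigma>'] by blast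
      ultimately show "(\<sigma>, \<tau>) \<in> R O S O C" by blast
    qed
  qed
  moreover have "implementable (R O S O C)"
    using implementable_clear_range by (intro implementable_relcomp R(1) S(1)) (simp add: C_def)
  ultimately show "\<exists>R. evaluates (RComp f gs) args d b R"
    unfolding evaluates_def by blast
qed

text \<open>
  Register \<open>b\<close> counts the remaining iterations, \<open>b + 1\<close> the completed ones, and \<open>b + 2\<close> holds the
  value reached so far. Testing \<open>b\<close> for zero after the loop discards the runs that leave it early;
  runs that stay too long are stuck at the decrement.
\<close>

lemma evaluable_RPrim:
  assumes "evaluable f" "evaluable g"
  shows "evaluable (RPrim f g)"
proof (rule evaluableI)
  fix args :: "nat list" and d b :: nat
  assume args: "set args \<subseteq> {..<b}" and d: "d < b"
  show "\<exists>R. evaluates (RPrim f g) args d b R"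
  proof (cases args)
    case Nil
    have "\<not> rec_eval (RPrim f g) [] y" for y
      by (auto elim: rec_eval.cases)
    with Nil show ?thesis by (intro evaluates_empty) simp
  next
    case (Cons a as)
    with args have a: "a < b" and as: "set as \<subseteq> {..<b}" by auto
    define b' where "b' = b + 3"
    obtain F where F: "implementable F"
      "\<And>\<sigma> \<tau>. clean b' \<sigma> \<Longrightarrow>
        (\<sigma>, \<tau>) \<in> F \<longleftrightarrow> (\<exists>y. rec_eval f (map \<sigma> as) y \<and> \<tau> = \<sigma>(b + 2 := y))"
      using as by (rule_tac evaluableE[OF assms(1), of as b' "b + 2"]) (auto simp: b'_def)
    obtain G where G: "implementable G"
      "\<And>\<sigma> \<tau>. clean b' \<sigma> \<Longrightarrow> (\<sigma>, \<tau>) \<in> G \<longleftrightarrow>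
        (\<exists>y. rec_eval g (map \<sigma> ((b + 1) # (b + 2) # as)) y \<and> \<tau> = \<sigma>(b + 2 := y))"
      using as
      by (rule_tac evaluableE[OF assms(2), of "(b + 1) # (b + 2) # as" b' "b + 2"])
        (auto simp: b'_def)
    define L where "L = opsem (Dec b) O G O opsem (Inc (b + 1))"
    define E where "E = opsem (Tst b) O opsem (Copy d (b + 2)) O clear (b + 1) O clear (b + 2)"
    have "(\<sigma>, \<tau>) \<in> opsem (Copy b a) O F O L\<^sup>* O E \<longleftrightarrow>
        (\<exists>y. rec_eval (RPrim f g) (map \<sigma> args) y \<and> \<tau> = \<sigma>(d := y))"
      if \<sigma>: "clean b \<sigma>" for \<sigma> \<tau>
    proof -
      define n where "n = \<sigma> a"
      define xs where "xs = map \<sigma> as"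
      define S where "S t y = \<sigma>(b := n - t, b + 1 := t, b + 2 := y)" for t y
      have zero: "\<sigma> b = 0" "\<sigma> (Suc b) = 0" "\<sigma> (Suc (Suc b)) = 0"
        using \<sigma> by (auto simp: clean_def)
      have as_upd: "map (\<sigma>(b := u, b + 1 := v, b + 2 := w)) as = xs" for u v w
        unfolding xs_def using as by (intro map_cong) auto
      have cl: "clean b' (\<sigma>(b := u, b + 1 := v, b + 2 := w))" for u v w
        using \<sigma> by (auto simp: clean_def b'_def)
      have F': "(\<sigma>(b := n), \<rho>) \<in> F \<longleftrightarrow> (\<exists>y. rec_eval f xs y \<and> \<rho> = S 0 y)" for \<rho>
      proof -
        have eq: "\<sigma>(b := n) = \<sigma>(b := n, b + 1 := 0, b + 2 := 0)"
          using zero by (auto simp: fun_eq_iff)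
        show ?thesis
          by (subst eq, subst F(2)[OF cl]) (simp only: as_upd S_def fun_upd_upd diff_zero)
      qed
      have L: "(S t y, \<rho>) \<in> L \<longleftrightarrow> (\<exists>z. t < n \<and> rec_eval g (t # y # xs) z \<and> \<rho> = S (Suc t) z)"
        for t y \<rho>
      proof -
        have dec: "(S t y, \<rho>) \<in> opsem (Dec b) \<longleftrightarrow>
            t < n \<and> \<rho> = \<sigma>(b := n - Suc t, b + 1 := t, b + 2 := y)" for \<rho>
        proof -
          have "S t y b = n - t" by (simp add: S_def)
          moreover have "(S t y)(b := n - t - 1) = \<sigma>(b := n - Suc t, b + 1 := t, b + 2 := y)"
            by (auto simp: S_def fun_eq_iff)
          ultimately show ?thesis by (auto simp: opsem_iff)
        qed
        define \<rho>\<^sub>0 where "\<rho>\<^sub>0 = \<sigma>(b := n - Suc t, b + 1 := t, b + 2 := y)"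
        have "map \<rho>\<^sub>0 ((b + 1) # (b + 2) # as) = t # y # xs"
          unfolding \<rho>\<^sub>0_def list.map as_upd by simp
        then have G': "(\<rho>\<^sub>0, \<rho>) \<in> G \<longleftrightarrow> (\<exists>z. rec_eval g (t # y # xs) z \<and> \<rho> = \<rho>\<^sub>0(b + 2 := z))" for \<rho>
          using G(2)[of \<rho>\<^sub>0 \<rho>] cl by (simp add: \<rho>\<^sub>0_def)
        have inc: "(\<rho>\<^sub>0(b + 2 := z), \<rho>) \<in> opsem (Inc (b + 1)) \<longleftrightarrow> \<rho> = S (Suc t) z" for z
        proof -
          have "\<rho>\<^sub>0 (b + 1) = t" by (simp add: \<rho>\<^sub>0_def)
          moreover have "\<rho>\<^sub>0(b + 2 := z, b + 1 := Suc t) = S (Suc t) z"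
            by (auto simp: S_def \<rho>\<^sub>0_def fun_eq_iff)
          ultimately show ?thesis by (simp add: opsem_iff)
        qed
        have "(S t y, \<rho>) \<in> L \<longleftrightarrow> t < n \<and> (\<rho>\<^sub>0, \<rho>) \<in> G O opsem (Inc (b + 1))"
          unfolding L_def relcomp_iff[of _ _ "opsem (Dec b)"] dec \<rho>\<^sub>0_def by simp
        also have "(\<rho>\<^sub>0, \<rho>) \<in> G O opsem (Inc (b + 1)) \<longleftrightarrow>
            (\<exists>z. rec_eval g (t # y # xs) z \<and> \<rho> = S (Suc t) z)"
          unfolding relcomp_iff G' inc[symmetric] by blast
        finally show ?thesis by simp
      qed
      \<comment> \<open>\<open>S t y\<close> is the store at the loop head after \<open>t\<close> iterations with value \<open>y\<close>.\<close>
      have sound: "\<exists>t y. t \<le> n \<and> \<rho> = S t y \<and> rec_eval (RPrim f g) (t # xs) y"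
        if "(S 0 y, \<rho>) \<in> L\<^sup>*" "rec_eval f xs y" for y \<rho>
        using that(1)
      proof (induction rule: rtrancl_induct)
        case base
        show ?case using rec_eval.prim_0[OF that(2)] by blast
      next
        case (step \<rho> \<rho>')
        then obtain t y where ty: "t \<le> n" "\<rho> = S t y" "rec_eval (RPrim f g) (t # xs) y" by blast
        with step(2) obtain z where "t < n" "rec_eval g (t # y # xs) z" "\<rho>' = S (Suc t) z"
          by (auto simp: L)
        with ty(3) show ?case
          by (metis Suc_leI rec_eval.prim_Suc)
      qed
      have complete: "t \<le> n \<Longrightarrow> \<exists>y0. rec_eval f xs y0 \<and> (S 0 y0, S t y) \<in> L\<^sup>*"
        if "rec_eval (RPrim f g) (t # xs) y" for t y
        using that
      proof (induction t arbitrary: y)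
        case 0
        then show ?case by (auto elim: rec_eval_RPrim_0E)
      next
        case (Suc t)
        from Suc.prems(2) obtain u where u: "rec_eval (RPrim f g) (t # xs) u" "rec_eval g (t # u # xs) y"
          by (auto elim: rec_eval_RPrim_SucE)
        with Suc obtain y0 where y0: "rec_eval f xs y0" "(S 0 y0, S t u) \<in> L\<^sup>*" by force
        have "(S t u, S (Suc t) y) \<in> L" using u Suc.prems(1) by (auto simp: L)
        with y0 show ?case by (meson rtrancl_into_rtrancl)
      qed
      have E: "(S t y, \<tau>) \<in> E \<longleftrightarrow> n \<le> t \<and> \<tau> = \<sigma>(d := y)" for t y
      proof -
        have "(\<sigma>(b := 0, b + 1 := t, b + 2 := y, d := y, b + 1 := 0, b + 2 := 0)) = \<sigma>(d := y)"
          using zero d by (auto simp: fun_eq_iff)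
        then show ?thesis
          by (auto simp: E_def relcomp_iff opsem_iff clear_iff S_def)
      qed
      have args_eq: "map \<sigma> args = n # xs" by (simp add: Cons n_def xs_def)
      have "(\<sigma>, \<tau>) \<in> opsem (Copy b a) O F O L\<^sup>* O E \<longleftrightarrow> (\<sigma>(b := n), \<tau>) \<in> F O L\<^sup>* O E"
        unfolding relcomp_iff[of _ _ "opsem (Copy b a)"] by (simp add: opsem_iff n_def)
      also have "\<dots> \<longleftrightarrow> (\<exists>y0 \<rho>. rec_eval f xs y0 \<and> (S 0 y0, \<rho>) \<in> L\<^sup>* \<and> (\<rho>, \<tau>) \<in> E)"
        unfolding relcomp_iff F' by blast
      also have "\<dots> \<longleftrightarrow> (\<exists>y. rec_eval (RPrim f g) (n # xs) y \<and> \<tau> = \<sigma>(d := y))"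
      proof
        assume "\<exists>y0 \<rho>. rec_eval f xs y0 \<and> (S 0 y0, \<rho>) \<in> L\<^sup>* \<and> (\<rho>, \<tau>) \<in> E"
        then show "\<exists>y. rec_eval (RPrim f g) (n # xs) y \<and> \<tau> = \<sigma>(d := y)"
          using sound E by (metis le_antisym)
      next
        assume "\<exists>y. rec_eval (RPrim f g) (n # xs) y \<and> \<tau> = \<sigma>(d := y)"
        then show "\<exists>y0 \<rho>. rec_eval f xs y0 \<and> (S 0 y0, \<rho>) \<in> L\<^sup>* \<and> (\<rho>, \<tau>) \<in> E"
          using complete E by (metis order_refl)
      qed
      finally show ?thesis unfolding args_eq .
    qed
    moreover have "implementable (opsem (Copy b a) O F O L\<^sup>* O E)"
      unfolding L_def E_def
      by (intro implementable_relcomp implementable_rtrancl implementable_op implementable_clear F(1) G(1))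
    ultimately show ?thesis unfolding evaluates_def by blast
  qed
qed

text \<open>
  Register \<open>b\<close> holds the candidate and \<open>b + 1\<close> the value at it. The decrement within the loop
  requires this value to be positive, the test after the loop requires it to be zero.
\<close>

lemma evaluable_RMu:
  assumes "evaluable f"
  shows "evaluable (RMu f)"
proof (rule evaluableI)
  fix args :: "nat list" and d b :: nat
  assume args: "set args \<subseteq> {..<b}" and d: "d < b"
  define b' where "b' = b + 2"
  obtain F where F: "implementable F"
    "\<And>\<sigma> \<tau>. clean b' \<sigma> \<Longrightarrow>
      (\<sigma>, \<tau>) \<in> F \<longleftrightarrow> (\<exists>y. rec_eval f (map \<sigma> (b # args)) y \<and> \<tau> = \<sigma>(b + 1 := y))"
    using args by (rule_tac evaluableE[OF assms(1), of "b # args" b' "b + 1"]) (auto simp: b'_def)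
  define L where "L = F O opsem (Dec (b + 1)) O clear (b + 1) O opsem (Inc b)"
  define E where "E = F O opsem (Tst (b + 1)) O opsem (Copy d b) O clear b"
  have "(\<sigma>, \<tau>) \<in> L\<^sup>* O E \<longleftrightarrow> (\<exists>y. rec_eval (RMu f) (map \<sigma> args) y \<and> \<tau> = \<sigma>(d := y))"
    if \<sigma>: "clean b \<sigma>" for \<sigma> \<tau>
  proof -
    define xs where "xs = map \<sigma> args"
    define S where "S t = \<sigma>(b := t)" for t
    have zero: "\<sigma> b = 0" "\<sigma> (Suc b) = 0" using \<sigma> by (auto simp: clean_def)
    have F': "(S t, \<rho>) \<in> F \<longleftrightarrow> (\<exists>y. rec_eval f (t # xs) y \<and> \<rho> = (S t)(b + 1 := y))" for t \<rho>
    proof -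
      have "clean b' (S t)" using \<sigma> by (auto simp: S_def clean_def b'_def)
      moreover have "map (S t) (b # args) = t # xs"
        using args by (auto simp: S_def xs_def)
      ultimately show ?thesis using F(2) by metis
    qed
    have L: "(S t, \<rho>) \<in> L \<longleftrightarrow> (\<exists>y. rec_eval f (t # xs) (Suc y)) \<and> \<rho> = S (Suc t)" for t \<rho>
    proof -
      have "(\<sigma>(b := t, b + 1 := u, b + 1 := v, b + 1 := 0, b := Suc t)) = \<sigma>(b := Suc t)" for u v
        using zero by (auto simp: fun_eq_iff)
      then show ?thesis
        unfolding L_def relcomp_iff F'
        by (auto simp: opsem_iff clear_iff S_def gr0_conv_Suc)
    qed
    have E: "(S t, \<tau>) \<in> E \<longleftrightarrow> rec_eval f (t # xs) 0 \<and> \<tau> = \<sigma>(d := t)" for t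
    proof -
      have "(\<sigma>(b := t, b + 1 := 0, d := t, b := 0)) = \<sigma>(d := t)"
        using zero d by (auto simp: fun_eq_iff)
      then show ?thesis
        unfolding E_def relcomp_iff F'
        by (auto simp: opsem_iff clear_iff S_def)
    qed
    have sound: "\<exists>t. \<rho> = S t \<and> (\<forall>m<t. \<exists>y. rec_eval f (m # xs) (Suc y))"
      if "(S 0, \<rho>) \<in> L\<^sup>*" for \<rho>
      using that
    proof (induction rule: rtrancl_induct)
      case (step \<rho> \<rho>')
      then show ?case using L less_Suc_eq by metis
    qed blast
    have complete: "(S 0, S t) \<in> L\<^sup>*" if "\<forall>m<t. \<exists>y. rec_eval f (m # xs) (Suc y)" for t
      using that
    proof (induction t)
      case (Suc t)
      then have "(S 0, S t) \<in> L\<^sup>*" "(S t, S (Suc t)) \<in> L" by (auto simp: L)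
      then show ?case by (rule rtrancl_into_rtrancl)
    qed simp
    have "S 0 = \<sigma>" using zero by (auto simp: S_def fun_eq_iff)
    then have "(\<sigma>, \<tau>) \<in> L\<^sup>* O E \<longleftrightarrow> (\<exists>\<rho>. (S 0, \<rho>) \<in> L\<^sup>* \<and> (\<rho>, \<tau>) \<in> E)"
      by (simp add: relcomp_iff)
    also have "\<dots> \<longleftrightarrow> (\<exists>y. rec_eval (RMu f) xs y \<and> \<tau> = \<sigma>(d := y))"
    proof
      assume "\<exists>\<rho>. (S 0, \<rho>) \<in> L\<^sup>* \<and> (\<rho>, \<tau>) \<in> E"
      then show "\<exists>y. rec_eval (RMu f) xs y \<and> \<tau> = \<sigma>(d := y)"
        using sound E rec_eval.mu by metis
    next
      assume "\<exists>y. rec_eval (RMu f) xs y \<and> \<tau> = \<sigma>(d := y)"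
      then obtain t where "rec_eval f (t # xs) 0" "\<forall>m<t. \<exists>y. rec_eval f (m # xs) (Suc y)"
        "\<tau> = \<sigma>(d := t)"
        by (auto elim: rec_eval_RMuE)
      then show "\<exists>\<rho>. (S 0, \<rho>) \<in> L\<^sup>* \<and> (\<rho>, \<tau>) \<in> E"
        using complete E by blast
    qed
    finally show ?thesis unfolding xs_def .
  qed
  moreover have "implementable (L\<^sup>* O E)"
    unfolding L_def E_def
    by (intro implementable_relcomp implementable_rtrancl implementable_op implementable_clear F(1))
  ultimately show "\<exists>R. evaluates (RMu f) args d b R"
    unfolding evaluates_def by blast
qed

lemma evaluable: "evaluable f"
  by (induction f)
    (simp_all add: evaluable_RZero evaluable_RSucc evaluable_RProj evaluable_RComp
      evaluable_RPrim evaluable_RMu)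

text \<open>
  The result is tested for zero and the input is erased, so that the final configuration does not
  depend on the input.
\<close>

lemma transition_system_for_recfun:
  obtains T :: "transition set" where "finite T" "T \<noteq> {}"
    "\<forall>x. (([0], (\<lambda>_. 0)(0 := x)), ([1], \<lambda>_. 0)) \<in> (step T)\<^sup>* \<longleftrightarrow> rec_eval f [x] 0"
proof -
  obtain R where R: "implementable R"
    "\<And>\<sigma> \<tau>. clean 2 \<sigma> \<Longrightarrow> (\<sigma>, \<tau>) \<in> R \<longleftrightarrow> (\<exists>y. rec_eval f (map \<sigma> [0]) y \<and> \<tau> = \<sigma>(1 := y))"
    by (rule evaluableE[OF evaluable, of "[0]" 2 1 f]) auto
  have "implementable (R O opsem (Tst 1) O clear 0)"
    by (intro implementable_relcomp implementable_op implementable_clear R(1))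
  then obtain T where T: "finite T" "T \<noteq> {}"
    "\<And>\<sigma> \<tau>. (\<sigma>, \<tau>) \<in> R O opsem (Tst 1) O clear 0 \<longleftrightarrow> (([0], \<sigma>), ([1], \<tau>)) \<in> (step T)\<^sup>*"
    unfolding implementable_def by blast
  have "((\<lambda>_. 0)(0 := x), \<lambda>_. 0) \<in> R O opsem (Tst 1) O clear 0 \<longleftrightarrow> rec_eval f [x] 0" for x
  proof -
    have "clean 2 ((\<lambda>_. 0)(0 := x))" by (simp add: clean_def)
    moreover have "((\<lambda>_. 0)(0 := x))(1 := 0, 0 := 0) = ((\<lambda>_. 0) :: store)" by (auto simp: fun_eq_iff)
    ultimately show ?thesis
      by (auto simp: relcomp_iff R(2) opsem_iff clear_iff)
  qed
  with T show ?thesis using that by metis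
qed

section \<open>Two matrices driving a family of letters\<close>

lemma zmax_0: "(0 :: zmax) = MInf" and zmax_1: "(1 :: zmax) = Fin 0"
  by (simp_all add: zero_maxplus_def one_maxplus_def)

lemma mat_list_prod_snoc:
  assumes "set As \<subseteq> carrier_mat n n" "A \<in> carrier_mat n n"
  shows "mat_list_prod n (As @ [A]) = mat_list_prod n As * A"
    and "mat_list_prod n As \<in> carrier_mat n n"
proof -
  have "foldr (*) As A = foldr (*) As (1\<^sub>m n) * A \<and> foldr (*) As (1\<^sub>m n) \<in> carrier_mat n n"
    using assms(1)
  proof (induction As)
    case (Cons B As)
    then show ?case
      using assms(2) assoc_mult_mat[of B n n "foldr (*) As (1\<^sub>m n)" n A n] by (simp add: mult_carrier_mat[where n = n])
  qed (use assms(2) in simp)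
  then show "mat_list_prod n (As @ [A]) = mat_list_prod n As * A"
    "mat_list_prod n As \<in> carrier_mat n n"
    using assms(2) by (simp_all add: mat_list_prod_def)
qed

text \<open>
  There are \<open>r\<close> letters, the matrices \<open>B s\<close> of size \<open>k\<close>. The coordinates of the two generators are
  grouped into \<open>r\<close> blocks of size \<open>k\<close>, and a row vector supported in the block \<open>s\<close> stands for a row
  vector of size \<open>k\<close> together with the letter \<open>s\<close> to be applied next.
\<close>

locale letters =
  fixes k r :: nat and B :: "nat \<Rightarrow> nat \<Rightarrow> nat \<Rightarrow> zmax"
  assumes k_pos: "0 < k" and r_pos: "0 < r"
begin

definition n :: nat where "n = r * k"

definition shift_mat :: "zmax mat" where
  "shift_mat = mat n n (\<lambda>(i, j). if i = (if j < k then j + (n - k) else j - k) then 1 else 0)"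

definition exec_mat :: "zmax mat" where
  "exec_mat = mat n n (\<lambda>(i, j). if j < k then B (i div k) (i mod k) j else 0)"

abbreviation generator :: "nat \<Rightarrow> zmax mat" where
  "generator a \<equiv> if a = 1 then shift_mat else exec_mat"

definition act :: "nat \<Rightarrow> (nat \<Rightarrow> zmax) \<Rightarrow> nat \<Rightarrow> zmax" where
  "act s g j = (\<Sum>i<k. g i * B s i j)"

fun run_step :: "nat \<Rightarrow> nat \<times> (nat \<Rightarrow> zmax) \<Rightarrow> nat \<times> (nat \<Rightarrow> zmax)" where
  "run_step a (s, g) = (if a = 1 then (Suc s mod r, g) else (0, act s g))"

definition unit_row :: "nat \<Rightarrow> nat \<Rightarrow> zmax" where
  "unit_row i j = (if j = i then 1 else 0)"

definition run :: "nat list \<Rightarrow> nat \<Rightarrow> nat \<times> (nat \<Rightarrow> zmax)" where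
  "run w l = fold run_step w (l div k, unit_row (l mod k))"

definition row_is :: "zmax mat \<Rightarrow> nat \<Rightarrow> nat \<times> (nat \<Rightarrow> zmax) \<Rightarrow> bool" where
  "row_is X l = (\<lambda>(s, g). s < r \<and> (\<forall>m<n. X $$ (l, m) = (if m div k = s then g (m mod k) else 0)))"

lemma k_le_n: "k \<le> n"
  using r_pos by (simp add: n_def)

lemma div_k_less: "l < n \<Longrightarrow> l div k < r"
  by (simp add: n_def less_mult_imp_div_less)

lemma run_Nil [simp]: "run [] l = (l div k, unit_row (l mod k))"
  by (simp add: run_def)

lemma run_snoc [simp]: "run (w @ [a]) l = run_step a (run w l)"
  by (simp add: run_def)

lemma shift_mat_carrier: "shift_mat \<in> carrier_mat n n"
  and exec_mat_carrier: "exec_mat \<in> carrier_mat n n"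
  by (simp_all add: shift_mat_def exec_mat_def)

text \<open>
  The column index of the shifted matrix is traced back to the block preceding it cyclically; the
  first block is preceded by the last one.
\<close>

lemma row_is_shift:
  assumes X: "X \<in> carrier_mat n n" and l: "l < n" and row: "row_is X l (s, g)"
  shows "row_is (X * shift_mat) l (Suc s mod r, g)"
proof -
  have s: "s < r" using row by (simp add: row_is_def)
  have "(X * shift_mat) $$ (l, m) = (if m div k = Suc s mod r then g (m mod k) else 0)"
    if m: "m < n" for m
  proof -
    define m' where "m' = (if m < k then m + (n - k) else m - k)"
    have m': "m' < n" using m k_le_n k_pos by (auto simp: m'_def)
    have "(X * shift_mat) $$ (l, m) = (\<Sum>i\<in>{0..<n}. X $$ (l, i) * shift_mat $$ (i, m))"
      using X l m by (simp add: scalar_prod_def shift_mat_def)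
    also have "\<dots> = (\<Sum>i\<in>{0..<n}. if i = m' then X $$ (l, i) else 0)"
      using m by (intro sum.cong) (auto simp: shift_mat_def m'_def)
    also have "\<dots> = X $$ (l, m')" using m' by simp
    also have "\<dots> = (if m' div k = s then g (m' mod k) else 0)"
      using row m' by (simp add: row_is_def)
    finally have entry: "(X * shift_mat) $$ (l, m) = (if m' div k = s then g (m' mod k) else 0)" .
    have "m' mod k = m mod k \<and> (m' div k = s \<longleftrightarrow> m div k = Suc s mod r)"
    proof (cases "m < k")
      case True
      have "n - k = (r - 1) * k" by (simp add: n_def diff_mult_distrib)
      then have "m' = m + (r - 1) * k" using True by (simp add: m'_def)
      with True have "m' mod k = m" "m' div k = r - 1" using k_pos by simp_all
      moreover have "r - 1 = s \<longleftrightarrow> 0 = Suc s mod r"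
        using s r_pos by (cases "Suc s = r") auto
      ultimately show ?thesis using True by simp
    next
      case False
      then have m_eq: "m = m' + k" by (simp add: m'_def)
      then have eq: "m mod k = m' mod k" "m div k = Suc (m' div k)"
        using k_pos by simp_all
      have "Suc (m' div k) < r" using div_k_less[OF m] eq by simp
      then have "m' div k = s \<longleftrightarrow> Suc (m' div k) = Suc s mod r"
        using s by (cases "Suc s = r") auto
      with eq show ?thesis by simp
    qed
    with entry show ?thesis by simp
  qed
  then show ?thesis using r_pos by (simp add: row_is_def)
qed

text \<open>
  Only the rows of the block \<open>s\<close> contribute to the product, and these contain the letter \<open>B s\<close>.
\<close>

lemma row_is_exec:
  assumes X: "X \<in> carrier_mat n n" and l: "l < n" and row: "row_is X l (s, g)"
  shows "row_is (X * exec_mat) l (0, act s g)"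
proof -
  have s: "s < r" using row by (simp add: row_is_def)
  have "(X * exec_mat) $$ (l, m) = (if m div k = 0 then act s g (m mod k) else 0)"
    if m: "m < n" for m
  proof (cases "m < k")
    case True
    have "(X * exec_mat) $$ (l, m) = (\<Sum>i\<in>{0..<n}. X $$ (l, i) * exec_mat $$ (i, m))"
      using X l m by (simp add: scalar_prod_def exec_mat_def)
    also have "\<dots> = (\<Sum>i\<in>{i\<in>{0..<n}. i div k = s}. g (i mod k) * B s (i mod k) m)"
      using row m True by (intro sum.mono_neutral_cong_right) (auto simp: row_is_def exec_mat_def)
    also have "\<dots> = (\<Sum>j<k. g j * B s j m)"
    proof (rule sum.reindex_bij_witness[where i = "\<lambda>j. s * k + j" and j = "\<lambda>i. i mod k"])
      fix j assume j: "j \<in> {..<k}"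
      have "s * k + j < Suc s * k" using j by simp
      also have "\<dots> \<le> n" unfolding n_def using s by (intro mult_le_mono1) simp
      finally show "s * k + j \<in> {i\<in>{0..<n}. i div k = s}" using j by simp
    qed (use k_pos in auto)
    finally show ?thesis using True by (simp add: act_def)
  next
    case False
    have "(X * exec_mat) $$ (l, m) = (\<Sum>i\<in>{0..<n}. X $$ (l, i) * exec_mat $$ (i, m))"
      using X l m by (simp add: scalar_prod_def exec_mat_def)
    also have "\<dots> = 0" using m False by (intro sum.neutral) (simp add: exec_mat_def)
    finally show ?thesis using False k_pos by (simp add: div_eq_0_iff)
  qed
  then show ?thesis using r_pos by (simp add: row_is_def)
qed

text \<open>
  The rows of a product evolve independently of each other, each one within a single block. Hence
  it suffices to follow pairs of a block and a row vector of size \<open>k\<close>. The rows start in different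
  blocks and are brought to a common one by the first \<open>exec_mat\<close>.
\<close>

lemma row_is_run:
  assumes "l < n"
  shows "row_is (mat_list_prod n (map generator w)) l (run w l)"
proof (induction w rule: rev_induct)
  case Nil
  have "l = m \<longleftrightarrow> m div k = l div k \<and> m mod k = l mod k" for m
    by (metis div_mult_mod_eq)
  then show ?case
    using assms div_k_less[OF assms]
    by (auto simp: row_is_def mat_list_prod_def unit_row_def)
next
  case (snoc a w)
  have carrier: "set (map generator w) \<subseteq> carrier_mat n n" "generator a \<in> carrier_mat n n"
    using shift_mat_carrier exec_mat_carrier by auto
  obtain s g where sg: "run w l = (s, g)" by fastforce
  show ?case
    using row_is_shift[OF mat_list_prod_snoc(2)[OF carrier] assms]
      row_is_exec[OF mat_list_prod_snoc(2)[OF carrier] assms] snoc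
    by (simp add: mat_list_prod_snoc(1)[OF carrier, simplified] sg)
qed

lemma run_block: "l < n \<Longrightarrow> fst (run w l) < r"
  using row_is_run[of l w] by (auto simp: row_is_def split: prod.splits)

lemma act_zero: "(\<And>i. i < k \<Longrightarrow> g i = MInf) \<Longrightarrow> act s g j = MInf"
  using zmax_0 by (simp add: act_def)

lemma run_replicate_shift:
  "run w l = (0, g) \<Longrightarrow> s < r \<Longrightarrow> run (w @ replicate s 1) l = (s, g)"
proof (induction s)
  case (Suc s)
  then show ?case
    using run_snoc[of "w @ replicate s 1" 1 l]
    by (simp del: run_snoc add: replicate_append_same[symmetric])
qed simp

end

section \<open>Registers as a max-plus row vector\<close>

fun guard :: "op \<Rightarrow> store \<Rightarrow> bool" where
  "guard (Dec i) \<sigma> \<longleftrightarrow> \<sigma> i \<noteq> 0"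
| "guard (Tst i) \<sigma> \<longleftrightarrow> \<sigma> i = 0"
| "guard _ \<sigma> \<longleftrightarrow> True"

fun source :: "op \<Rightarrow> nat \<Rightarrow> nat" where
  "source (Copy i l) j = (if j = i then l else j)"
| "source _ j = j"

fun incr :: "op \<Rightarrow> nat \<Rightarrow> int" where
  "incr (Inc i) j = (if j = i then 1 else 0)"
| "incr (Dec i) j = (if j = i then -1 else 0)"
| "incr _ j = 0"

fun op_regs :: "op \<Rightarrow> nat set" where
  "op_regs (Copy i l) = {i, l}"
| "op_regs (Inc i) = {i}"
| "op_regs (Dec i) = {i}"
| "op_regs (Tst i) = {i}"

lemma finite_op_regs: "finite (op_regs a)"
  by (cases a) auto

text \<open>
  An operation is a guard and an update adding a constant to the old value of some register.
  This is the form that is max-plus linear.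
\<close>

lemma opsem_affine:
  "(\<sigma>, \<tau>) \<in> opsem a \<longleftrightarrow> guard a \<sigma> \<and> (\<forall>i. int (\<tau> i) = int (\<sigma> (source a i)) + incr a i)"
proof (cases a)
  case (Copy i l)
  then show ?thesis by (auto simp: opsem_iff fun_eq_iff)
next
  case (Inc i)
  have "int (\<tau> j) = int (\<sigma> (source a j)) + incr a j \<longleftrightarrow> \<tau> j = (\<sigma>(i := Suc (\<sigma> i))) j" for j
    using Inc by auto
  with Inc show ?thesis by (simp add: opsem_iff fun_eq_iff del: fun_upd_apply)
next
  case (Dec i)
  have "int (\<tau> j) = int (\<sigma> (source a j)) + incr a j \<longleftrightarrow> \<tau> j = (\<sigma>(i := \<sigma> i - 1)) j"
    if "\<sigma> i \<noteq> 0" for j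
    using Dec that by auto
  with Dec show ?thesis
    by (auto simp add: opsem_iff fun_eq_iff simp del: fun_upd_apply source.simps incr.simps)
next
  case (Tst i)
  then show ?thesis by (auto simp: opsem_iff fun_eq_iff)
qed

text \<open>
  Since addition is the maximum, \<open>nonpos\<close> of a sum is the conjunction over its terms. This is how a
  single error value checks several tests.
\<close>

definition nonpos :: "zmax \<Rightarrow> bool" where
  "nonpos z \<longleftrightarrow> (\<forall>c. z = Fin c \<longrightarrow> c \<le> 0)"

lemma nonpos_simps [simp]: "nonpos MInf" "nonpos (Fin c) \<longleftrightarrow> c \<le> 0"
  by (simp_all add: nonpos_def)

lemma nonpos_plus: "nonpos (y + z) \<longleftrightarrow> nonpos y \<and> nonpos z"
  by (cases y; cases z) auto

lemma nonpos_sum: "finite A \<Longrightarrow> nonpos (sum f A) \<longleftrightarrow> (\<forall>i\<in>A. nonpos (f i))"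
  by (induction A rule: finite_induct) (auto simp: nonpos_plus zmax_0)

lemma sum_ge_Fin:
  assumes "finite A" "i \<in> A" "f i = Fin c"
  shows "\<exists>d\<ge>c. sum f A = (Fin d :: zmax)"
proof -
  have "sum f A = Fin c + sum f (A - {i})"
    using assms by (simp add: sum.remove)
  then show ?thesis by (cases "sum f (A - {i})") auto
qed

text \<open>
  The guards as inequalities \<open>v + c \<le> 0\<close>, with \<open>Fin c\<close> the value of \<open>bound\<close> at the coordinate
  holding \<open>v\<close>. Being nonzero is \<open>- v + 1 \<le> 0\<close>, at the coordinate of the negated register, and being
  zero is \<open>v \<le> 0\<close>, as registers are never negative.
\<close>

fun bound :: "op \<Rightarrow> nat \<Rightarrow> zmax" where
  "bound (Dec i) j = (if j = 2 * i + 3 then Fin 1 else MInf)"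
| "bound (Tst i) j = (if j = 2 * i + 2 then Fin 0 else MInf)"
| "bound _ j = MInf"

definition signed :: "nat \<Rightarrow> int \<Rightarrow> int" where
  "signed j c = (if even j then c else - c)"

text \<open>
  Coordinate \<open>0\<close> is the reference value and coordinate \<open>1\<close> the error value. Register \<open>i\<close> is at
  \<open>2 * i + 2\<close> and its negation at \<open>2 * i + 3\<close>, for \<open>i < K\<close>; the code of the control state takes the
  place of register \<open>K\<close>.
\<close>

definition config_row :: "nat \<Rightarrow> nat list \<Rightarrow> store \<Rightarrow> nat \<Rightarrow> int" where
  "config_row K p \<sigma> j = (if j < 2 then 0
     else signed j (int (if j div 2 - 1 < K then \<sigma> (j div 2 - 1) else list_encode p)))"

text \<open>
  Besides the guard, a transition has to check that the control state is \<open>p\<close>. This equality is a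
  pair of inequalities between its code and the code of \<open>p\<close>.
\<close>

definition test_weight :: "nat \<Rightarrow> nat list \<Rightarrow> op \<Rightarrow> nat \<Rightarrow> zmax" where
  "test_weight K p a i = (if i = 2 * K + 2 then Fin (- int (list_encode p))
     else if i = 2 * K + 3 then Fin (int (list_encode p)) else bound a i)"

text \<open>
  The new control state is a constant, obtained by adding its code to the reference value in
  row \<open>0\<close>.
\<close>

definition source_row :: "nat \<Rightarrow> op \<Rightarrow> nat \<Rightarrow> nat" where
  "source_row K a j = (if 2 \<le> j \<and> j div 2 - 1 < K then 2 * source a (j div 2 - 1) + 2 + j mod 2 else 0)"

definition offset :: "nat \<Rightarrow> op \<Rightarrow> nat list \<Rightarrow> nat \<Rightarrow> int" where
  "offset K a q j = (if j < 2 then 0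
     else signed j (if j div 2 - 1 < K then incr a (j div 2 - 1) else int (list_encode q)))"

fun letter :: "nat \<Rightarrow> transition \<Rightarrow> nat \<Rightarrow> nat \<Rightarrow> zmax" where
  "letter K (p, a, q) i j = (if j = 1 then (if i = 1 then Fin 0 else test_weight K p a i)
     else if i = source_row K a j then Fin (offset K a q j) else MInf)"

definition input :: "nat \<Rightarrow> store" where
  "input x = (\<lambda>_. 0)(0 := x)"

definition reset :: "nat \<Rightarrow> nat \<Rightarrow> nat \<Rightarrow> nat \<Rightarrow> zmax" where
  "reset K x i j = (if i = 0 then Fin (config_row K [0] (input x) j) else MInf)"

lemma config_row_0_1 [simp]: "config_row K p \<sigma> 0 = 0" "config_row K p \<sigma> (Suc 0) = 0"
  by (simp_all add: config_row_def)

lemma config_row_simps: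
  "i < K \<Longrightarrow> config_row K p \<sigma> (2 * i + 2) = int (\<sigma> i)"
  "i < K \<Longrightarrow> config_row K p \<sigma> (2 * i + 3) = - int (\<sigma> i)"
  "config_row K p \<sigma> (2 * K + 2) = int (list_encode p)"
  "config_row K p \<sigma> (2 * K + 3) = - int (list_encode p)"
  by (simp_all add: config_row_def signed_def)

text \<open>
  Row \<open>1\<close> is excluded because it carries the error value itself.
\<close>

lemma tests_pass_iff:
  assumes "op_regs a \<subseteq> {..<K}"
  shows "(\<forall>i<2 * K + 4. i \<noteq> 1 \<longrightarrow> nonpos (Fin (config_row K p' \<sigma> i) * test_weight K p a i)) \<longleftrightarrow> p' = p \<and> guard a \<sigma>"
    (is "?L \<longleftrightarrow> ?R")
proof
  assume L: ?L
  have "list_encode p' = list_encode p"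
    using L[rule_format, of "2 * K + 2"] L[rule_format, of "2 * K + 3"]
    by (simp add: config_row_simps config_row_simps[simplified] test_weight_def)
  moreover have "guard a \<sigma>"
  proof (cases a)
    case (Dec i)
    with assms L[rule_format, of "2 * i + 3"] show ?thesis
      by (simp add: config_row_simps config_row_simps[simplified] test_weight_def split: if_splits)
  next
    case (Tst i)
    with assms L[rule_format, of "2 * i + 2"] show ?thesis
      by (simp add: config_row_simps config_row_simps[simplified] test_weight_def split: if_splits)
  qed simp_all
  ultimately show ?R by (simp add: list_encode_eq)
next
  assume R: ?R
  show ?L
  proof (intro allI impI)
    fix i assume "i < 2 * K + 4" "i \<noteq> 1"
    show "nonpos (Fin (config_row K p' \<sigma> i) * test_weight K p a i)"
      using R assms by (cases a) (auto simp: test_weight_def config_row_simps config_row_simps[simplified])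
  qed
qed

lemma config_row_update:
  assumes "(\<sigma>, \<tau>) \<in> opsem a" "op_regs a \<subseteq> {..<K}" "2 \<le> j"
  shows "config_row K q \<tau> j = config_row K p \<sigma> (source_row K a j) + offset K a q j"
proof (cases "j div 2 - 1 < K")
  case True
  define i where "i = j div 2 - 1"
  have "source a i < K" using True assms(2) by (cases a) (auto simp: i_def)
  moreover have "int (\<tau> i) = int (\<sigma> (source a i)) + incr a i"
    using assms(1) by (simp add: opsem_affine)
  moreover have "even (2 * source a i + 2 + j mod 2) \<longleftrightarrow> even j"
    "(2 * source a i + 2 + j mod 2) div 2 - 1 = source a i" by (auto simp: even_iff_mod_2_eq_zero)
  ultimately show ?thesis
    using True assms(3) by (simp add: config_row_def source_row_def offset_def signed_def i_def)
next
  case False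
  with assms(3) show ?thesis by (simp add: config_row_def source_row_def offset_def)
qed

lemma source_row_less: "op_regs a \<subseteq> {..<K} \<Longrightarrow> source_row K a j < 2 * K + 4"
proof -
  assume "op_regs a \<subseteq> {..<K}"
  moreover have "j mod 2 < 2" by simp
  ultimately show ?thesis by (cases a) (auto simp: source_row_def intro!: add_less_le_mono)
qed

section \<open>The matrices of a transition system\<close>

text \<open>
  Letter \<open>0\<close> is the reset to the initial configuration with input \<open>x\<close>, the others are the
  transitions. The target has the final configuration in the rows of the reference coordinates,
  the only ones that survive a reset.
\<close>

locale machine =
  fixes K :: nat and ts :: "transition list" and x :: nat
  assumes K_pos: "0 < K" and ts_nonempty: "ts \<noteq> []"
    and regs: "\<And>p a q. (p, a, q) \<in> set ts \<Longrightarrow> op_regs a \<subseteq> {..<K}"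
begin

definition the_letter :: "nat \<Rightarrow> nat \<Rightarrow> nat \<Rightarrow> zmax" where
  "the_letter s = (if s = 0 then reset K x else letter K (ts ! (s - 1)))"

sublocale letters "2 * K + 4" "Suc (length ts)" the_letter
  by unfold_locales simp_all

definition target :: "zmax mat" where
  "target = mat n n (\<lambda>(l, m). if l mod (2 * K + 4) = 0 \<and> m < 2 * K + 4
     then Fin (config_row K [1] (\<lambda>_. 0) m) else MInf)"

lemma act_reset: "act 0 g j = g 0 * Fin (config_row K [0] (input x) j)"
proof -
  have "act 0 g j = (\<Sum>i\<in>{0}. g i * the_letter 0 i j)"
    unfolding act_def by (rule sum.mono_neutral_right) (auto simp: the_letter_def reset_def zmax_0)
  then show ?thesis by (simp add: the_letter_def reset_def)
qed

lemma the_letter_Suc: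
  assumes "s < Suc (length ts)" "s \<noteq> 0"
  obtains p a q where "(p, a, q) \<in> set ts" "the_letter s = letter K (p, a, q)"
    "op_regs a \<subseteq> {..<K}"
proof -
  obtain p a q where "ts ! (s - 1) = (p, a, q)" by (metis prod_cases3)
  moreover have "ts ! (s - 1) \<in> set ts" using assms by (intro nth_mem) simp
  ultimately show ?thesis using that assms(2) regs by (simp add: the_letter_def)
qed

text \<open>
  Whatever the vector is, the letter performs its update on all coordinates but the error. The
  new error value is zero iff the old one is and all tests succeed.
\<close>

lemma act_letter:
  assumes u: "\<And>i. i < 2 * K + 4 \<Longrightarrow> g i = Fin (u i)" "u 0 = 0" "u 1 \<ge> 0"
    and letter: "the_letter s = letter K (p, a, q)" and a: "op_regs a \<subseteq> {..<K}"
  obtains u' where "\<And>i. i < 2 * K + 4 \<Longrightarrow> act s g i = Fin (u' i)" "u' 0 = 0" "u' 1 \<ge> 0"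
    "u' 1 = 0 \<longleftrightarrow> u 1 = 0 \<and>
       (\<forall>i<2 * K + 4. i \<noteq> 1 \<longrightarrow> nonpos (Fin (u i) * test_weight K p a i))"
    "\<And>j. 2 \<le> j \<Longrightarrow> j < 2 * K + 4 \<Longrightarrow> u' j = u (source_row K a j) + offset K a q j"
proof -
  have other: "act s g j = Fin (u (source_row K a j) + offset K a q j)" if "j \<noteq> 1" for j
  proof -
    have "act s g j = (\<Sum>i\<in>{source_row K a j}. g i * the_letter s i j)"
      unfolding act_def
      by (rule sum.mono_neutral_right) (use that source_row_less[OF a] u in \<open>auto simp: letter zmax_0\<close>)
    then show ?thesis using that source_row_less[OF a] u by (simp add: letter)
  qed
  define e where "e i = g i * the_letter s i 1" for i
  have act_e: "act s g 1 = sum e {..<2 * K + 4}"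
    by (simp add: act_def e_def)
  have e1: "e 1 = Fin (u 1)" using u by (simp add: e_def letter)
  have "\<exists>d\<ge>u 1. sum e {..<2 * K + 4} = Fin d"
    by (rule sum_ge_Fin[where i = 1]) (use e1 in simp_all)
  then obtain d where d: "d \<ge> u 1" "act s g 1 = Fin d"
    unfolding act_e by blast
  have "d \<le> 0 \<longleftrightarrow> nonpos (act s g 1)" unfolding d by simp
  also have "\<dots> \<longleftrightarrow> (\<forall>i<2 * K + 4. nonpos (e i))"
    unfolding act_e nonpos_sum[OF finite_lessThan] by auto
  also have "\<dots> \<longleftrightarrow> nonpos (e 1) \<and> (\<forall>i<2 * K + 4. i \<noteq> 1 \<longrightarrow> nonpos (e i))"
  proof -
    have "1 < 2 * K + 4" by simp
    then show ?thesis by blast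
  qed
  also have "\<dots> \<longleftrightarrow> u 1 \<le> 0 \<and> (\<forall>i<2 * K + 4. i \<noteq> 1 \<longrightarrow> nonpos (Fin (u i) * test_weight K p a i))"
    using u by (auto simp: e1 e_def letter)
  finally have d0: "d = 0 \<longleftrightarrow> u 1 = 0 \<and>
       (\<forall>i<2 * K + 4. i \<noteq> 1 \<longrightarrow> nonpos (Fin (u i) * test_weight K p a i))"
    using d(1) u(3) by auto
  show ?thesis
  proof (rule that[of "\<lambda>j. if j = 1 then d else u (source_row K a j) + offset K a q j"])
    show "act s g i = Fin (if i = 1 then d else u (source_row K a i) + offset K a q i)" for i
      using d(2) other by simp
  qed (use d0 d(1) u in \<open>auto simp: source_row_def offset_def\<close>)
qed

lemma act_letter_vec:
  assumes "\<And>i. i < 2 * K + 4 \<Longrightarrow> g i = Fin (config_row K p \<sigma> i)" "(\<sigma>, \<tau>) \<in> opsem a"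
    and letter: "the_letter s = letter K (p, a, q)" and a: "op_regs a \<subseteq> {..<K}"
    and j: "j < 2 * K + 4"
  shows "act s g j = Fin (config_row K q \<tau> j)"
proof -
  show ?thesis
  proof (rule act_letter[OF assms(1) _ _ letter a])
    fix u' assume u': "\<And>i. i < 2 * K + 4 \<Longrightarrow> act s g i = Fin (u' i)" "u' 0 = 0"
      "u' 1 = 0 \<longleftrightarrow> config_row K p \<sigma> 1 = 0 \<and>
         (\<forall>i<2 * K + 4. i \<noteq> 1 \<longrightarrow> nonpos (Fin (config_row K p \<sigma> i) * test_weight K p a i))"
      "\<And>j. 2 \<le> j \<Longrightarrow> j < 2 * K + 4 \<Longrightarrow> u' j = config_row K p \<sigma> (source_row K a j) + offset K a q j"
    have "u' 1 = 0"
      using tests_pass_iff[OF a, of p \<sigma> p] assms(2) u'(3) by (simp add: opsem_affine)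
    then have "u' j = config_row K q \<tau> j"
      using u'(2) u'(4)[of j] config_row_update[OF assms(2) a, of j q p] j
      by (cases "j < 2") (auto simp: less_2_cases_iff)
    then show ?thesis using u'(1) j by simp
  qed simp_all
qed

text \<open>
  All letters preserve the reference value, and no other coordinate contributes to it.
\<close>

lemma act_column_0:
  assumes "s < Suc (length ts)"
  shows "act s g 0 = g 0"
proof -
  have col: "the_letter s i 0 = (if i = 0 then 1 else 0)" for i
  proof (cases "s = 0")
    case True
    then show ?thesis by (simp add: the_letter_def reset_def zmax_0 zmax_1)
  next
    case False
    with assms obtain p a q where "the_letter s = letter K (p, a, q)"
      by (rule the_letter_Suc)
    then show ?thesis by (simp add: source_row_def offset_def zmax_0 zmax_1)
  qed
  have "act s g 0 = (\<Sum>i\<in>{0}. g i * the_letter s i 0)"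
    unfolding act_def by (rule sum.mono_neutral_right) (auto simp: col)
  then show ?thesis by (simp add: col)
qed

section \<open>Words simulating a run\<close>

definition carries :: "nat list \<Rightarrow> nat list \<Rightarrow> store \<Rightarrow> bool" where
  "carries w p \<sigma> \<longleftrightarrow> (\<forall>l<n. fst (run w l) = 0 \<and> (\<forall>j<2 * K + 4. snd (run w l) j =
     (if l mod (2 * K + 4) = 0 then Fin (config_row K p \<sigma> j) else MInf)))"

text \<open>
  The first execution brings all rows to block \<open>0\<close>, where the second one applies the reset.
  The reference value is \<open>1\<close> in the rows of the reference coordinates and \<open>0\<close> (as elements of the
  semiring) in all others, so that the latter vanish.
\<close>

lemma carries_reset: "carries [2, 2] [0] (input x)"
  unfolding carries_def
proof (intro allI impI conjI)
  fix l assume l: "l < n"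
  have run: "run [2, 2] l = (0, act 0 (act (l div (2 * K + 4)) (unit_row (l mod (2 * K + 4)))))"
    by (simp add: run_def)
  then show "fst (run [2, 2] l) = 0" by simp
  fix j
  show "snd (run [2, 2] l) j =
      (if l mod (2 * K + 4) = 0 then Fin (config_row K [0] (input x) j) else MInf)"
    unfolding run snd_conv act_reset act_column_0[OF div_k_less[OF l]]
    by (simp add: unit_row_def zmax_0 zmax_1)
qed

text \<open>
  A transition is executed by shifting to its block first.
\<close>

lemma carries_step:
  assumes w: "carries w p \<sigma>" and t: "(p, a, q) \<in> set ts" "(\<sigma>, \<tau>) \<in> opsem a"
  shows "\<exists>v. set v \<subseteq> {1, 2} \<and> carries (w @ v) q \<tau>"
proof -
  obtain i where i: "i < length ts" "ts ! i = (p, a, q)"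
    using t(1) by (auto simp: in_set_conv_nth)
  define v where "v = replicate (Suc i) (1::nat) @ [2]"
  have letter: "the_letter (Suc i) = letter K (p, a, q)" by (simp add: the_letter_def i)
  have "carries (w @ v) q \<tau>"
    unfolding carries_def
  proof (intro allI impI conjI)
    fix l assume l: "l < n"
    obtain g where g: "run w l = (0, g)"
      "\<And>j. j < 2 * K + 4 \<Longrightarrow> g j = (if l mod (2 * K + 4) = 0 then Fin (config_row K p \<sigma> j) else MInf)"
      using w l unfolding carries_def by (metis prod.collapse)
    have "run (w @ replicate (Suc i) 1) l = (Suc i, g)"
      using g(1) i(1) by (intro run_replicate_shift) simp_all
    then have run: "run (w @ v) l = (0, act (Suc i) g)"
      using run_snoc[of "w @ replicate (Suc i) 1" 2 l] by (simp add: v_def)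
    then show "fst (run (w @ v) l) = 0" by simp
    fix j assume j: "j < 2 * K + 4"
    show "snd (run (w @ v) l) j =
        (if l mod (2 * K + 4) = 0 then Fin (config_row K q \<tau> j) else MInf)"
    proof (cases "l mod (2 * K + 4) = 0")
      case True
      then show ?thesis
        using act_letter_vec[OF _ t(2) letter regs[OF t(1)] j, of g] g(2) by (simp add: run)
    next
      case False
      then show ?thesis using act_zero[of g "Suc i" j] g(2) by (simp add: run)
    qed
  qed
  moreover have "set v \<subseteq> {1, 2}" by (auto simp: v_def)
  ultimately show ?thesis by blast
qed

lemma carries_reachable:
  assumes "(([0], input x), (q, \<tau>)) \<in> (step (set ts))\<^sup>*"
  shows "\<exists>w. w \<noteq> [] \<and> set w \<subseteq> {1, 2} \<and> carries w q \<tau>"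
  using assms
proof (induction rule: rtrancl_induct2)
  case refl
  show ?case by (rule exI[of _ "[2, 2]"]) (simp add: carries_reset)
next
  case (step p \<sigma> q \<tau>)
  from step(2) obtain a where "(p, a, q) \<in> set ts" "(\<sigma>, \<tau>) \<in> opsem a"
    unfolding step_def by blast
  moreover from step(3) obtain w where w: "w \<noteq> []" "set w \<subseteq> {1, 2}" "carries w p \<sigma>" by blast
  ultimately obtain v where "set v \<subseteq> {1, 2}" "carries (w @ v) q \<tau>"
    using carries_step by blast
  with w show ?case by (intro exI[of _ "w @ v"]) auto
qed

section \<open>Words reaching the target\<close>

text \<open>
  Any word is in one of three stages. It is \<open>fresh\<close> before the first execution, when the rows are
  still unit vectors in different blocks; \<open>unset\<close> when all rows are in the same block but no reset
  has erased the error value of some row outside the reference coordinates; \<open>tracking\<close> once a reset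
  has been applied. In the last stage row \<open>0\<close> is the configuration reached by the transitions
  executed since the last reset, unless its error value is positive. Only this stage is compatible
  with the target.
\<close>

definition fresh :: "nat list \<Rightarrow> bool" where
  "fresh w \<longleftrightarrow> (\<exists>a<Suc (length ts). \<forall>l<n. run w l =
     ((l div (2 * K + 4) + a) mod Suc (length ts), unit_row (l mod (2 * K + 4))))"

definition unset :: "nat list \<Rightarrow> bool" where
  "unset w \<longleftrightarrow> (\<exists>s. \<forall>l<n. fst (run w l) = s) \<and> snd (run w 0) 0 = Fin 0 \<and>
     (\<exists>l<n. l mod (2 * K + 4) \<noteq> 0 \<and> (\<exists>e. snd (run w l) 1 = Fin e))"

definition reachable_config_row :: "(nat \<Rightarrow> int) \<Rightarrow> bool" where
  "reachable_config_row u \<longleftrightarrow> (\<exists>p \<sigma>. (\<forall>j<2 * K + 4. u j = config_row K p \<sigma> j) \<and> (\<forall>i\<ge>K. \<sigma> i = 0) \<and>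
     (([0], input x), (p, \<sigma>)) \<in> (step (set ts))\<^sup>*)"

definition tracking :: "nat list \<Rightarrow> bool" where
  "tracking w \<longleftrightarrow> (\<exists>u. (\<forall>j<2 * K + 4. snd (run w 0) j = Fin (u j)) \<and> u 0 = 0 \<and> u 1 \<ge> 0 \<and>
     (u 1 = 0 \<longrightarrow> reachable_config_row u))"

lemma n_ge: "2 * K + 4 \<le> n"
  by (rule k_le_n)

lemma index_less_n: "s < Suc (length ts) \<Longrightarrow> j < 2 * K + 4 \<Longrightarrow> s * (2 * K + 4) + j < n"
proof -
  assume "s < Suc (length ts)" and j: "j < 2 * K + 4"
  then have "Suc s * (2 * K + 4) \<le> n" unfolding n_def by (intro mult_le_mono1) simp
  with j show ?thesis by simp
qed

lemma fresh_Nil: "fresh []"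
  unfolding fresh_def using div_k_less by (intro exI[of _ 0]) simp

lemma fresh_shift:
  assumes "fresh w"
  shows "fresh (w @ [1])"
proof -
  obtain a where "\<And>l. l < n \<Longrightarrow> run w l =
     ((l div (2 * K + 4) + a) mod Suc (length ts), unit_row (l mod (2 * K + 4)))"
    using assms unfolding fresh_def by blast
  then have "run (w @ [1]) l =
     ((l div (2 * K + 4) + Suc a mod Suc (length ts)) mod Suc (length ts), unit_row (l mod (2 * K + 4)))"
    if "l < n" for l
    using that by (simp add: mod_Suc_eq mod_add_right_eq del: mod_Suc)
  then show ?thesis
    unfolding fresh_def by (intro exI[of _ "Suc a mod Suc (length ts)"]) simp
qed

text \<open>
  A transition copies the error value to itself with weight \<open>0\<close>, so it never becomes \<open>-\<infinity>\<close>.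
\<close>

lemma act_err:
  assumes "s < Suc (length ts)" "s \<noteq> 0" "g 1 = Fin e"
  shows "\<exists>e'. act s g 1 = Fin e'"
proof -
  obtain p a q where "the_letter s = letter K (p, a, q)"
    using assms(1,2) by (rule the_letter_Suc)
  then have "g 1 * the_letter s 1 1 = Fin e" using assms(3) by simp
  then show ?thesis
    unfolding act_def using sum_ge_Fin[of "{..<2 * K + 4}" 1 "\<lambda>i. g i * the_letter s i 1"] by auto
qed

text \<open>
  At this execution the rows are subject to different letters. Some row with an error value is in
  block \<open>1\<close> and thus escapes the reset even if others undergo it.
\<close>

lemma fresh_exec:
  assumes "fresh w" "c \<noteq> 1"
  shows "unset (w @ [c])"
proof -
  let ?k = "2 * K + 4" and ?r = "Suc (length ts)"
  obtain a where a: "a < ?r" and run: "\<And>l. l < n \<Longrightarrow> run w l =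
     ((l div ?k + a) mod ?r, unit_row (l mod ?k))"
    using assms(1) unfolding fresh_def by blast
  have run': "run (w @ [c]) l = (0, act ((l div ?k + a) mod ?r) (unit_row (l mod ?k)))"
    if "l < n" for l
    using run[OF that] assms(2) by simp
  \<comment> \<open>the block that has been shifted to block \<open>1\<close>, where the first transition is applied\<close>
  define b where "b = (1 + (?r - a)) mod ?r"
  define l where "l = b * ?k + 1"
  have "b < ?r" by (simp add: b_def)
  then have "l < n" unfolding l_def by (rule index_less_n) simp
  moreover have "l mod ?k = 1"
    unfolding l_def by (subst mod_mult_self3) simp
  moreover have "l div ?k = b"
    unfolding l_def by (subst div_mult_self3) simp_all
  moreover have "(b + a) mod ?r = 1"
  proof -
    have "(b + a) mod ?r = (1 + (?r - a) + a) mod ?r"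
      unfolding b_def by (rule mod_add_left_eq)
    also have "\<dots> = (1 + ?r) mod ?r" using a by simp
    also have "\<dots> = 1" using ts_nonempty by (simp only: mod_add_self2) simp
    finally show ?thesis .
  qed
  moreover have "\<exists>e. act 1 (unit_row 1) 1 = Fin e"
    using ts_nonempty by (intro act_err) (auto simp: unit_row_def zmax_1)
  ultimately have "\<exists>l<n. l mod ?k \<noteq> 0 \<and> (\<exists>e. snd (run (w @ [c]) l) 1 = Fin e)"
    using run'[of l] by (intro exI[of _ l]) simp
  moreover have "snd (run (w @ [c]) 0) 0 = Fin 0"
  proof -
    have "0 < n" using n_ge by simp
    then have "snd (run (w @ [c]) 0) 0 = unit_row 0 0"
      using a by (simp add: run' act_column_0 del: run_snoc)
    then show ?thesis by (simp add: unit_row_def zmax_1)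
  qed
  moreover have "\<forall>l<n. fst (run (w @ [c]) l) = 0" using run' by simp
  ultimately show ?thesis unfolding unset_def by blast
qed

lemma unset_shift:
  assumes "unset w"
  shows "unset (w @ [1])"
proof -
  have "run (w @ [1]) l = (Suc (fst (run w l)) mod Suc (length ts), snd (run w l))" for l
    by (cases "run w l") simp
  then show ?thesis using assms unfolding unset_def by (simp del: run_snoc) metis
qed

lemma reachable_config_row_reset: "reachable_config_row (config_row K [0] (input x))"
  unfolding reachable_config_row_def using K_pos
  by (intro exI[of _ "[0]"] exI[of _ "input x"]) (simp add: input_def)

lemma tracking_reset:
  assumes "run w 0 = (0, g)" "g 0 = Fin 0" "c \<noteq> 1"
  shows "tracking (w @ [c])"
  unfolding tracking_def using assms reachable_config_row_reset
  by (intro exI[of _ "config_row K [0] (input x)"]) (simp add: act_reset)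

text \<open>
  As all rows are in the same block, a reset applies to row \<open>0\<close> in particular, and any other letter
  keeps the error value alive.
\<close>

lemma unset_exec:
  assumes "unset w" "c \<noteq> 1"
  shows "unset (w @ [c]) \<or> tracking (w @ [c])"
proof -
  obtain s where s: "\<And>l. l < n \<Longrightarrow> fst (run w l) = s"
    using assms(1) unfolding unset_def by blast
  have "0 < n" using n_ge by simp
  with s have s_less: "s < Suc (length ts)" using run_block by blast
  have run: "run (w @ [c]) l = (0, act s (snd (run w l)))" if "l < n" for l
    using s[OF that] assms(2) by (cases "run w l") simp
  show ?thesis
  proof (cases "s = 0")
    case True
    have "run w 0 = (0, snd (run w 0))" using s[OF \<open>0 < n\<close>] True by (metis prod.collapse)
    then show ?thesis using tracking_reset assms unfolding unset_def by blast
  next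
    case False
    obtain l e where l: "l < n" "l mod (2 * K + 4) \<noteq> 0" "snd (run w l) 1 = Fin e"
      using assms(1) unfolding unset_def by blast
    then have "\<exists>e. snd (run (w @ [c]) l) 1 = Fin e"
      using act_err[OF s_less False] by (simp add: run del: run_snoc)
    moreover have "snd (run (w @ [c]) 0) 0 = Fin 0"
      using assms(1) \<open>0 < n\<close> by (simp add: run act_column_0 s_less unset_def del: run_snoc)
    moreover have "\<forall>l<n. fst (run (w @ [c]) l) = 0" using run by simp
    ultimately show ?thesis using l unfolding unset_def by blast
  qed
qed

lemma tracking_step:
  assumes "tracking w"
  shows "tracking (w @ [c])"
proof -
  obtain s g where run: "run w 0 = (s, g)" by fastforce
  obtain u where u: "\<And>j. j < 2 * K + 4 \<Longrightarrow> g j = Fin (u j)" "u 0 = 0" "u 1 \<ge> 0"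
    "u 1 = 0 \<Longrightarrow> reachable_config_row u"
    using assms run unfolding tracking_def by auto
  have s_less: "s < Suc (length ts)" using run_block[of 0 w] run n_ge by simp
  consider "c = 1" | "c \<noteq> 1" "s = 0" | "c \<noteq> 1" "s \<noteq> 0" by blast
  then show ?thesis
  proof cases
    case 1
    then show ?thesis unfolding tracking_def using u run by (intro exI[of _ u]) simp
  next
    case 2
    then show ?thesis using tracking_reset[of w g c] run u(1)[of 0] u(2) by simp
  next
    case 3
    obtain p a q where paq: "(p, a, q) \<in> set ts" "the_letter s = letter K (p, a, q)"
      "op_regs a \<subseteq> {..<K}"
      by (rule the_letter_Suc[OF s_less 3(2)])
    show ?thesis
    proof (rule act_letter[OF u(1-3) paq(2,3)])
      fix u' assume u': "\<And>i. i < 2 * K + 4 \<Longrightarrow> act s g i = Fin (u' i)" "u' 0 = 0" "u' 1 \<ge> 0"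
        "u' 1 = 0 \<longleftrightarrow> u 1 = 0 \<and>
           (\<forall>i<2 * K + 4. i \<noteq> 1 \<longrightarrow> nonpos (Fin (u i) * test_weight K p a i))"
        "\<And>j. 2 \<le> j \<Longrightarrow> j < 2 * K + 4 \<Longrightarrow> u' j = u (source_row K a j) + offset K a q j"
      have "reachable_config_row u'" if "u' 1 = 0"
      proof -
        from that u'(4) have u1: "u 1 = 0"
          and tests: "\<forall>i<2 * K + 4. i \<noteq> 1 \<longrightarrow> nonpos (Fin (u i) * test_weight K p a i)" by blast+
        from u(4)[OF u1] obtain p' \<sigma> where p': "\<And>j. j < 2 * K + 4 \<Longrightarrow> u j = config_row K p' \<sigma> j"
          "\<And>i. i \<ge> K \<Longrightarrow> \<sigma> i = 0" "(([0], input x), (p', \<sigma>)) \<in> (step (set ts))\<^sup>*"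
          unfolding reachable_config_row_def by blast
        from tests have "\<forall>i<2 * K + 4. i \<noteq> 1 \<longrightarrow> nonpos (Fin (config_row K p' \<sigma> i) * test_weight K p a i)"
          using p'(1) by simp
        then have "p' = p" "guard a \<sigma>" using tests_pass_iff[OF paq(3)] by blast+
        then obtain \<tau> where \<tau>: "(\<sigma>, \<tau>) \<in> opsem a"
          by (cases a) (auto simp: opsem_iff)
        have "u' j = config_row K q \<tau> j" if "j < 2 * K + 4" for j
          using that u'(2) \<open>u' 1 = 0\<close> u'(5)[of j] p'(1)[OF source_row_less[OF paq(3)]]
            config_row_update[OF \<tau> paq(3), of j q p']
          by (cases "j < 2") (auto simp: less_2_cases_iff)
        moreover have "\<tau> i = 0" if "i \<ge> K" for i
        proof -
          have "source a i = i" "incr a i = 0"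
            using paq(3) that by (cases a; auto)+
          with \<tau> p'(2)[OF that] show ?thesis
            unfolding opsem_affine by (metis add.right_neutral of_nat_eq_0_iff)
        qed
        moreover have "(([0], input x), (q, \<tau>)) \<in> (step (set ts))\<^sup>*"
          using p'(3) stepI[OF paq(1) \<tau>] \<open>p' = p\<close> by (meson rtrancl_into_rtrancl)
        ultimately show ?thesis unfolding reachable_config_row_def by blast
      qed
      then show ?thesis
        unfolding tracking_def using u' run 3 by (intro exI[of _ u']) simp
    qed
  qed
qed

lemma fresh_unset_or_tracking: "fresh w \<or> unset w \<or> tracking w"
proof (induction w rule: rev_induct)
  case Nil
  show ?case using fresh_Nil by blast
next
  case (snoc c w)
  from snoc consider "fresh w" | "unset w" | "tracking w" by blast
  then show ?case
  proof cases
    case 1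
    then show ?thesis using fresh_shift[of w] fresh_exec[of w c] by (cases "c = 1") simp_all
  next
    case 2
    then show ?thesis using unset_shift[of w] unset_exec[of w c] by (cases "c = 1") simp_all
  next
    case 3
    then show ?thesis using tracking_step by simp
  qed
qed

lemma product_entry:
  assumes "l < n" "j < 2 * K + 4" "run w l = (s, g)"
  shows "mat_list_prod n (map generator w) $$ (l, s * (2 * K + 4) + j) = g j"
    and "s * (2 * K + 4) + j < n"
proof -
  have s: "s < Suc (length ts)" using run_block[OF assms(1), of w] assms(3) by simp
  then show less: "s * (2 * K + 4) + j < n" using assms(2) by (rule index_less_n)
  have "(s * (2 * K + 4) + j) div (2 * K + 4) = s" "(s * (2 * K + 4) + j) mod (2 * K + 4) = j"
    using assms(2) by simp_all
  then show "mat_list_prod n (map generator w) $$ (l, s * (2 * K + 4) + j) = g j"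
    using row_is_run[OF assms(1), of w] less unfolding assms(3) row_is_def by simp
qed

lemma product_carrier: "mat_list_prod n (map generator w) \<in> carrier_mat n n"
  by (rule mat_list_prod_snoc(2)[OF _ shift_mat_carrier]) (auto simp: shift_mat_carrier exec_mat_carrier)

text \<open>
  The reference value \<open>0\<close> of row \<open>0\<close> forces it into block \<open>0\<close> and the factor of proportionality to
  be \<open>0\<close>. Then the error value is \<open>0\<close> as in the target, and the configuration tracked by row \<open>0\<close> is
  reachable and equal to the final one.
\<close>

lemma reachable_if_proportional:
  assumes "proportional (mat_list_prod n (map generator w)) target"
  shows "(([0], input x), ([1], \<lambda>_. 0)) \<in> (step (set ts))\<^sup>*"
proof -
  let ?k = "2 * K + 4"
  obtain c where c: "\<And>l m. l < n \<Longrightarrow> m < n \<Longrightarrow>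
      rmax_of_zmax (mat_list_prod n (map generator w) $$ (l, m)) = Fin c * rmax_of_zmax (target $$ (l, m))"
    using assms unfolding proportional_def by (auto simp: target_def)
  have dead: "snd (run w l) j = MInf" if "l < n" "l mod ?k \<noteq> 0" "j < ?k" for l j
  proof -
    obtain s g where sg: "run w l = (s, g)" by fastforce
    note entry = product_entry[OF that(1,3) sg]
    have "target $$ (l, s * ?k + j) = MInf" using that entry(2) by (simp add: target_def)
    then have "rmax_of_zmax (g j) = MInf" using c[OF that(1) entry(2)] entry(1) by simp
    then show ?thesis by (cases "g j") (simp_all add: sg)
  qed
  have "\<not> fresh w"
  proof
    assume "fresh w"
    then obtain s where "run w 1 = (s, unit_row 1)"
      using n_ge by (auto simp: fresh_def)
    with dead[of 1 1] n_ge show False by (simp add: unit_row_def zmax_1)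
  qed
  moreover have "\<not> unset w"
    using dead[of _ 1] by (auto simp: unset_def)
  ultimately have "tracking w" using fresh_unset_or_tracking by blast
  obtain s g where sg: "run w 0 = (s, g)" by fastforce
  obtain u where u: "\<And>j. j < ?k \<Longrightarrow> g j = Fin (u j)" "u 0 = 0"
    "u 1 = 0 \<Longrightarrow> reachable_config_row u"
    using \<open>tracking w\<close> sg unfolding tracking_def by auto
  have "0 < n" using n_ge by simp
  have entry: "rmax_of_zmax (Fin (u j)) = Fin c * rmax_of_zmax (target $$ (0, s * ?k + j))"
    "s * ?k + j < n" if "j < ?k" for j
  proof -
    note e = product_entry[OF \<open>0 < n\<close> that sg]
    show "rmax_of_zmax (Fin (u j)) = Fin c * rmax_of_zmax (target $$ (0, s * ?k + j))"
      using c[OF \<open>0 < n\<close> e(2)] unfolding e(1) u(1)[OF that] .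
    show "s * ?k + j < n" by (rule e(2))
  qed
  have "s = 0"
  proof (rule ccontr)
    assume "s \<noteq> 0"
    then have "target $$ (0, s * ?k + 0) = MInf"
      using entry(2)[of 0] \<open>0 < n\<close> by (simp add: target_def)
    then show False using entry(1)[of 0] by simp
  qed
  have shifted: "real_of_int (u j) = c + real_of_int (config_row K [1] (\<lambda>_. 0) j)" if "j < ?k" for j
    using entry[OF that] that \<open>0 < n\<close> by (simp add: \<open>s = 0\<close> target_def)
  have "c = 0" using shifted[of 0] u(2) by simp
  with shifted have final: "u j = config_row K [1] (\<lambda>_. 0) j" if "j < ?k" for j
    using that by simp
  then have "u 1 = 0" by simp
  then obtain p \<sigma> where p: "\<And>j. j < ?k \<Longrightarrow> u j = config_row K p \<sigma> j" "\<And>i. i \<ge> K \<Longrightarrow> \<sigma> i = 0"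
    "(([0], input x), (p, \<sigma>)) \<in> (step (set ts))\<^sup>*"
    using u(3) unfolding reachable_config_row_def by blast
  have eq: "config_row K p \<sigma> j = config_row K [1] (\<lambda>_. 0) j" if "j < ?k" for j
    using p(1)[OF that] final[OF that] by simp
  have "list_encode p = list_encode [1]"
    using eq[of "2 * K + 2"] unfolding config_row_simps by simp
  then have "p = [1]" unfolding list_encode_eq .
  moreover have "\<sigma> i = 0" for i
  proof (cases "i < K")
    case True
    then show ?thesis using eq[of "2 * i + 2"] unfolding config_row_simps(1)[OF True] by simp
  qed (use p(2) in simp)
  then have "\<sigma> = (\<lambda>_. 0)" by blast
  ultimately show ?thesis using p(3) by simp
qed

lemma proportional_if_carries:
  assumes "carries w [1] (\<lambda>_. 0)"
  shows "proportional (mat_list_prod n (map generator w)) target"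
proof -
  have "mat_list_prod n (map generator w) $$ (l, m) = target $$ (l, m)" if l: "l < n" and m: "m < n" for l m
  proof -
    obtain g where g: "run w l = (0, g)" "\<And>j. j < 2 * K + 4 \<Longrightarrow> g j =
        (if l mod (2 * K + 4) = 0 then Fin (config_row K [1] (\<lambda>_. 0) j) else MInf)"
      using assms l unfolding carries_def by (metis prod.collapse)
    have "mat_list_prod n (map generator w) $$ (l, m) =
        (if m div (2 * K + 4) = 0 then g (m mod (2 * K + 4)) else MInf)"
      using row_is_run[OF l, of w] m by (simp add: row_is_def g(1) zmax_0)
    then show ?thesis using l m g(2) by (simp add: target_def div_eq_0_iff)
  qed
  moreover have "Fin 0 * rmax_of_zmax z = rmax_of_zmax z" for z by (cases z) simp_all
  ultimately show ?thesis
    unfolding proportional_def using product_carrier[of w]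
    by (auto simp: target_def intro!: exI[of _ 0])
qed

lemma product_proportional_iff:
  "(\<exists>w. w \<noteq> [] \<and> set w \<subseteq> {1, 2} \<and> proportional (mat_list_prod n (map generator w)) target) \<longleftrightarrow>
   (([0], input x), ([1], \<lambda>_. 0)) \<in> (step (set ts))\<^sup>*"
proof
  show "\<exists>w. w \<noteq> [] \<and> set w \<subseteq> {1, 2} \<and> proportional (mat_list_prod n (map generator w)) target"
    if "(([0], input x), ([1], \<lambda>_. 0)) \<in> (step (set ts))\<^sup>*"
    using carries_reachable[OF that] proportional_if_carries by metis
qed (elim exE conjE, rule reachable_if_proportional)

end


section \<open>Some total recursive functions\<close>

definition recursive :: "nat \<Rightarrow> (nat list \<Rightarrow> nat) \<Rightarrow> bool" where
  "recursive k F \<longleftrightarrow> (\<exists>r. \<forall>xs. length xs = k \<longrightarrow> rec_eval r xs (F xs))"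

lemma recursiveI: "(\<And>xs. length xs = k \<Longrightarrow> rec_eval r xs (F xs)) \<Longrightarrow> recursive k F"
  unfolding recursive_def by blast

lemma recursive_proj: "i < k \<Longrightarrow> recursive k (\<lambda>xs. xs ! i)"
  by (rule recursiveI[of _ "RProj i"]) (simp add: rec_eval.proj)

lemma recursive_comp1:
  assumes "recursive 1 (\<lambda>xs. f (xs ! 0))" "recursive k G"
  shows "recursive k (\<lambda>xs. f (G xs))"
proof -
  obtain r where r: "\<And>xs. length xs = 1 \<Longrightarrow> rec_eval r xs (f (xs ! 0))"
    using assms(1) unfolding recursive_def by blast
  obtain s where s: "\<And>xs. length xs = k \<Longrightarrow> rec_eval s xs (G xs)"
    using assms(2) unfolding recursive_def by blast
  show ?thesis
  proof (rule recursiveI)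
    fix xs :: "nat list" assume "length xs = k"
    then show "rec_eval (RComp r [s]) xs (f (G xs))"
      using r[of "[G xs]"] by (intro rec_eval.comp[where ys = "[G xs]"]) (simp_all add: s)
  qed
qed

lemma recursive_comp2:
  assumes "recursive 2 (\<lambda>xs. f (xs ! 0) (xs ! 1))" "recursive k G" "recursive k H"
  shows "recursive k (\<lambda>xs. f (G xs) (H xs))"
proof -
  obtain r where r: "\<And>xs. length xs = 2 \<Longrightarrow> rec_eval r xs (f (xs ! 0) (xs ! 1))"
    using assms(1) unfolding recursive_def by blast
  obtain s where s: "\<And>xs. length xs = k \<Longrightarrow> rec_eval s xs (G xs)"
    using assms(2) unfolding recursive_def by blast
  obtain t where t: "\<And>xs. length xs = k \<Longrightarrow> rec_eval t xs (H xs)"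
    using assms(3) unfolding recursive_def by blast
  show ?thesis
  proof (rule recursiveI)
    fix xs :: "nat list" assume "length xs = k"
    then show "rec_eval (RComp r [s, t]) xs (f (G xs) (H xs))"
      using r[of "[G xs, H xs]"]
      by (intro rec_eval.comp[where ys = "[G xs, H xs]"]) (simp_all add: s t)
  qed
qed

lemma recursive_Suc: "recursive k G \<Longrightarrow> recursive k (\<lambda>xs. Suc (G xs))"
proof (rule recursive_comp1[where f = Suc])
  show "recursive 1 (\<lambda>xs. Suc (xs ! 0))"
    by (rule recursiveI[of _ RSucc]) (auto simp: length_Suc_conv rec_eval.succ)
qed

lemma recursive_const: "recursive k (\<lambda>xs. c)"
proof (induction c)
  case 0
  show ?case by (rule recursiveI[of _ RZero]) (rule rec_eval.zero)
next
  case (Suc c)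
  then show ?case by (rule recursive_Suc)
qed

lemma recursive_prim:
  assumes "recursive k F" "recursive (Suc (Suc k)) G"
    and "\<And>xs. length xs = k \<Longrightarrow> H (0 # xs) = F xs"
    and "\<And>n xs. length xs = k \<Longrightarrow> H (Suc n # xs) = G (n # H (n # xs) # xs)"
  shows "recursive (Suc k) H"
proof -
  obtain r where r: "\<And>xs. length xs = k \<Longrightarrow> rec_eval r xs (F xs)"
    using assms(1) unfolding recursive_def by blast
  obtain s where s: "\<And>xs. length xs = Suc (Suc k) \<Longrightarrow> rec_eval s xs (G xs)"
    using assms(2) unfolding recursive_def by blast
  have "rec_eval (RPrim r s) (n # xs) (H (n # xs))" if xs: "length xs = k" for n xs
  proof (induction n)
    case 0
    show ?case using r[OF xs] by (simp add: assms(3) xs rec_eval.prim_0)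
  next
    case (Suc n)
    show ?case
      by (rule rec_eval.prim_Suc[OF Suc]) (use s xs in \<open>simp add: assms(4)\<close>)
  qed
  then show ?thesis
    by (intro recursiveI[of _ "RPrim r s"]) (auto simp: length_Suc_conv)
qed

lemma recursive_mu:
  assumes "recursive (Suc k) F"
    and "\<And>xs. length xs = k \<Longrightarrow> F (N xs # xs) = 0"
    and "\<And>m xs. length xs = k \<Longrightarrow> m < N xs \<Longrightarrow> F (m # xs) \<noteq> 0"
  shows "recursive k N"
proof -
  obtain r where r: "\<And>xs. length xs = Suc k \<Longrightarrow> rec_eval r xs (F xs)"
    using assms(1) unfolding recursive_def by blast
  show ?thesis
  proof (rule recursiveI[of _ "RMu r"], rule rec_eval.mu)
    fix xs :: "nat list" assume xs: "length xs = k"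
    show "rec_eval r (N xs # xs) 0"
      using r[of "N xs # xs"] xs assms(2) by simp
    show "\<forall>m<N xs. \<exists>y. rec_eval r (m # xs) (Suc y)"
      using r xs assms(3) by (metis length_Cons not0_implies_Suc)
  qed
qed

lemma recursive_add: "recursive k G \<Longrightarrow> recursive k H \<Longrightarrow> recursive k (\<lambda>xs. G xs + H xs)"
proof (rule recursive_comp2[where f = "(+)"])
  have "recursive (Suc 1) (\<lambda>xs. xs ! 0 + xs ! 1)"
    by (rule recursive_prim[of 1 "\<lambda>xs. xs ! 0" "\<lambda>xs. Suc (xs ! 1)"])
      (simp_all add: recursive_proj recursive_Suc)
  then show "recursive 2 (\<lambda>xs. xs ! 0 + xs ! 1)"
    by (simp add: numeral_2_eq_2)
qed

lemma recursive_diff: "recursive k G \<Longrightarrow> recursive k H \<Longrightarrow> recursive k (\<lambda>xs. G xs - H xs)"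
proof -
  have "recursive (Suc 0) (\<lambda>xs. xs ! 0 - 1)"
    by (rule recursive_prim[of 0 "\<lambda>xs. 0" "\<lambda>xs. xs ! 0"])
      (simp_all add: recursive_proj recursive_const)
  then have pred: "recursive j (\<lambda>xs. F xs - 1)" if "recursive j F" for F j
    using recursive_comp1[where f = "\<lambda>n. n - 1", OF _ that] by simp
  have "recursive (Suc 1) (\<lambda>xs. xs ! 1 - xs ! 0)"
    by (rule recursive_prim[of 1 "\<lambda>xs. xs ! 0" "\<lambda>xs. xs ! 1 - 1"])
      (simp_all add: recursive_proj pred[simplified])
  then have "recursive 2 (\<lambda>xs. xs ! 1 - xs ! 0)"
    by (simp add: numeral_2_eq_2)
  then show "recursive k G \<Longrightarrow> recursive k H \<Longrightarrow> recursive k (\<lambda>xs. G xs - H xs)"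
    using recursive_comp2[where f = "\<lambda>a b. b - a" and G = H and H = G and k = k] by simp
qed

lemma recursive_triangle: "recursive k G \<Longrightarrow> recursive k (\<lambda>xs. triangle (G xs))"
proof (rule recursive_comp1[where f = triangle])
  have "recursive (Suc 0) (\<lambda>xs. triangle (xs ! 0))"
    by (rule recursive_prim[of 0 "\<lambda>xs. 0" "\<lambda>xs. xs ! 1 + Suc (xs ! 0)"])
      (simp_all add: recursive_proj recursive_const recursive_add recursive_Suc)
  then show "recursive 1 (\<lambda>xs. triangle (xs ! 0))" by simp
qed

lemma recursive_prod_encode:
  "recursive k G \<Longrightarrow> recursive k H \<Longrightarrow> recursive k (\<lambda>xs. prod_encode (G xs, H xs))"
  unfolding prod_encode_def by (simp add: recursive_add recursive_triangle)

text \<open>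
  The sum of the components of the pair coded by \<open>z\<close>. Both components are obtained from it by
  subtraction.
\<close>

definition diagonal :: "nat \<Rightarrow> nat" where
  "diagonal z = (LEAST s. z < triangle (Suc s))"

lemma mono_triangle: "mono triangle"
  by (simp add: mono_iff_le_Suc)

lemma diagonal_prod_encode: "diagonal (prod_encode (a, b)) = a + b"
  unfolding diagonal_def
proof (rule Least_equality)
  show "prod_encode (a, b) < triangle (Suc (a + b))"
    by (simp add: prod_encode_def)
  fix s assume "prod_encode (a, b) < triangle (Suc s)"
  then have "triangle (a + b) < triangle (Suc s)"
    by (simp add: prod_encode_def)
  then have "a + b < Suc s"
    using monoD[OF mono_triangle] by (meson not_le)
  then show "a + b \<le> s" by simp
qed

lemma recursive_diagonal: "recursive k G \<Longrightarrow> recursive k (\<lambda>xs. diagonal (G xs))"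
proof (rule recursive_comp1[where f = diagonal])
  have least: "z < triangle (Suc (diagonal z))" for z
    unfolding diagonal_def by (rule LeastI[of _ z]) simp
  show "recursive 1 (\<lambda>xs. diagonal (xs ! 0))"
  proof (rule recursive_mu)
    show "recursive (Suc 1) (\<lambda>xs. Suc (xs ! 1) - triangle (Suc (xs ! 0)))"
      by (intro recursive_diff recursive_triangle recursive_Suc recursive_proj) auto
  next
    fix xs :: "nat list"
    show "Suc ((diagonal (xs ! 0) # xs) ! 1) - triangle (Suc ((diagonal (xs ! 0) # xs) ! 0)) = 0"
      using least[of "xs ! 0"] by (simp del: triangle_Suc)
  next
    fix m and xs :: "nat list"
    assume "m < diagonal (xs ! 0)"
    then have "\<not> xs ! 0 < triangle (Suc m)"
      unfolding diagonal_def by (rule not_less_Least)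
    then show "Suc ((m # xs) ! 1) - triangle (Suc ((m # xs) ! 0)) \<noteq> 0"
      by (simp del: triangle_Suc)
  qed
qed

lemma prod_decode_diagonal:
  "fst (prod_decode z) = z - triangle (diagonal z)"
  "snd (prod_decode z) = diagonal z - fst (prod_decode z)"
proof -
  obtain a b where "z = prod_encode (a, b)"
    by (metis prod_decode_inverse surj_pair)
  moreover have "a = prod_encode (a, b) - triangle (a + b)"
    by (simp add: prod_encode_def)
  ultimately show "fst (prod_decode z) = z - triangle (diagonal z)"
    "snd (prod_decode z) = diagonal z - fst (prod_decode z)"
    by (simp_all add: diagonal_prod_encode)
qed

lemma recursive_fst: "recursive k G \<Longrightarrow> recursive k (\<lambda>xs. fst (prod_decode (G xs)))"
  by (simp add: prod_decode_diagonal(1) recursive_diff recursive_triangle recursive_diagonal)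

lemma recursive_snd: "recursive k G \<Longrightarrow> recursive k (\<lambda>xs. snd (prod_decode (G xs)))"
  by (simp add: prod_decode_diagonal(2) recursive_diff recursive_fst recursive_diagonal)

section \<open>Instances and their codes\<close>

text \<open>
  The entries of the second matrix for a blank input. They are those for any input except at
  row \<open>0\<close>, columns \<open>2\<close> and \<open>3\<close>, where the reset letter provides register \<open>0\<close> and its negation.
\<close>

definition fixed_entry :: "nat \<Rightarrow> transition list \<Rightarrow> nat \<Rightarrow> nat \<Rightarrow> zmax" where
  "fixed_entry K ts i j =
     (if j < 2 * K + 4
      then if i div (2 * K + 4) = 0
        then if i = 0 then Fin (config_row K [0] (\<lambda>_. 0) j) else MInf
        else letter K (ts ! (i div (2 * K + 4) - 1)) (i mod (2 * K + 4)) j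
      else MInf)"

definition row_tail_code :: "nat \<Rightarrow> transition list \<Rightarrow> nat \<Rightarrow> nat" where
  "row_tail_code K ts n = list_encode (map (\<lambda>j. zmax_code (fixed_entry K ts 0 j)) [4..<n])"

definition rows_tail_code :: "nat \<Rightarrow> transition list \<Rightarrow> nat \<Rightarrow> nat" where
  "rows_tail_code K ts n =
     list_encode (map (\<lambda>i. list_encode (map (\<lambda>j. zmax_code (fixed_entry K ts i j)) [0..<n])) [1..<n])"

text \<open>
  The code of an instance in terms of its parts: dimension \<open>n\<close>, first matrix \<open>a\<close>, second matrix
  with \<open>t\<close> the end of its first row from column \<open>4\<close> on and \<open>u\<close> its other rows, and target \<open>m\<close>.
  The successors come from \<open>list_encode\<close> and \<open>zmax_code\<close>; the first row starts with the entries
  \<open>0\<close>, \<open>0\<close>, \<open>x\<close>, \<open>- x\<close>.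
\<close>

definition assemble :: "nat \<Rightarrow> nat \<Rightarrow> nat \<Rightarrow> nat \<Rightarrow> nat \<Rightarrow> nat \<Rightarrow> nat" where
  "assemble n a t u m x =
     Suc (prod_encode (n, Suc (prod_encode (a, Suc (prod_encode (
       Suc (prod_encode (
         Suc (prod_encode (1, Suc (prod_encode (1, Suc (prod_encode (Suc (x + x),
           Suc (prod_encode (Suc (x + x - 1), t)))))))),
         u)),
       Suc (prod_encode (m, 0))))))))"

text \<open>
  Truncated subtraction makes the second equation cover the case \<open>x = 0\<close>.
\<close>

lemma int_encode_of_nat: "int_encode (int x) = x + x" "int_encode (- int x) = x + x - 1"
  by (auto simp: int_encode_def sum_encode_def)

context machine
begin

lemma exec_mat_entry:
  assumes "i < n" "j < n" "i \<noteq> 0 \<or> 4 \<le> j"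
  shows "exec_mat $$ (i, j) = fixed_entry K ts i j"
proof -
  have "config_row K [0] (input x) j = config_row K [0] (\<lambda>_. 0) j" if "4 \<le> j"
  proof -
    have "j div 2 - 1 \<noteq> 0" using that by auto
    then show ?thesis by (simp add: config_row_def input_def)
  qed
  moreover have "i = 0" if "i mod (2 * K + 4) = 0" "i div (2 * K + 4) = 0"
    using that by (metis div_mult_mod_eq add.right_neutral mult_0)
  ultimately show ?thesis
    using assms by (auto simp: exec_mat_def fixed_entry_def the_letter_def reset_def zmax_0)
qed

lemma exec_mat_start:
  "exec_mat $$ (0, 0) = Fin 0" "exec_mat $$ (0, 1) = Fin 0"
  "exec_mat $$ (0, 2) = Fin (int x)" "exec_mat $$ (0, 3) = Fin (- int x)"
  using n_ge K_pos
  by (simp_all add: exec_mat_def the_letter_def reset_def config_row_def signed_def input_def)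

lemma exec_mat_code:
  "zmax_mat_code exec_mat = list_encode (
     list_encode (1 # 1 # Suc (x + x) # Suc (x + x - 1) #
       map (\<lambda>j. zmax_code (fixed_entry K ts 0 j)) [4..<n]) #
     map (\<lambda>i. list_encode (map (\<lambda>j. zmax_code (fixed_entry K ts i j)) [0..<n])) [1..<n])"
proof -
  have n4: "4 \<le> n" using n_ge by simp
  define row where "row i = list_encode (map (\<lambda>j. zmax_code (exec_mat $$ (i, j))) [0..<n])" for i
  have code: "zmax_mat_code exec_mat = list_encode (map row [0..<n])"
    unfolding zmax_mat_code_def mat_to_list_def row_def using exec_mat_carrier
    by (simp add: comp_def)
  have rows: "[0..<n] = 0 # [1..<n]"
    using n4 by (simp add: upt_conv_Cons)
  have columns: "[0..<n] = 0 # 1 # 2 # 3 # [4..<n]"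
    using n4 by (simp add: upt_conv_Cons eval_nat_numeral)
  have tail: "map (\<lambda>j. zmax_code (exec_mat $$ (0, j))) [4..<n] =
      map (\<lambda>j. zmax_code (fixed_entry K ts 0 j)) [4..<n]"
    using n4 by (intro map_cong) (simp_all add: exec_mat_entry)
  have "row 0 = list_encode (1 # 1 # Suc (x + x) # Suc (x + x - 1) #
      map (\<lambda>j. zmax_code (fixed_entry K ts 0 j)) [4..<n])"
    unfolding row_def columns list.map exec_mat_start tail
    by (simp add: int_encode_of_nat int_encode_of_nat(1)[of 0, simplified])
  moreover have "row i = list_encode (map (\<lambda>j. zmax_code (fixed_entry K ts i j)) [0..<n])"
    if "i \<in> set [1..<n]" for i
    unfolding row_def using that
    by (intro arg_cong[where f = list_encode] map_cong) (simp_all add: exec_mat_entry)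
  then have "map row [1..<n] =
      map (\<lambda>i. list_encode (map (\<lambda>j. zmax_code (fixed_entry K ts i j)) [0..<n])) [1..<n]"
    by (intro map_cong) simp_all
  moreover have "map row [0..<n] = row 0 # map row [1..<n]"
    by (subst rows) simp
  ultimately show ?thesis unfolding code by (simp only:)
qed

lemma instance_code_eq_assemble:
  "instance_code (n, shift_mat, exec_mat, target) = assemble n (zmax_mat_code shift_mat)
     (row_tail_code K ts n) (rows_tail_code K ts n) (zmax_mat_code target) x"
  by (simp add: assemble_def exec_mat_code row_tail_code_def rows_tail_code_def)

lemma instance_in_zmax_instances: "(n, shift_mat, exec_mat, target) \<in> zmax_instances"
  using n_ge shift_mat_carrier exec_mat_carrier by (simp add: zmax_instances_def target_def)

end

text \<open>
  The number \<open>c\<close> serves both as the code of the five parts and as the input placed into the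
  instance.
\<close>

definition self_assemble :: "nat \<Rightarrow> nat" where
  "self_assemble c = assemble (fst (prod_decode c)) (fst (prod_decode (snd (prod_decode c))))
     (fst (prod_decode (snd (prod_decode (snd (prod_decode c))))))
     (fst (prod_decode (snd (prod_decode (snd (prod_decode (snd (prod_decode c))))))))
     (snd (prod_decode (snd (prod_decode (snd (prod_decode (snd (prod_decode c)))))))) c"

lemma self_assemble:
  "self_assemble (prod_encode (n, prod_encode (a, prod_encode (t, prod_encode (u, m))))) =
   assemble n a t u m (prod_encode (n, prod_encode (a, prod_encode (t, prod_encode (u, m)))))"
  by (simp add: self_assemble_def)

lemma recursive_self_assemble: "recursive 1 (\<lambda>xs. self_assemble (xs ! 0))"
  unfolding self_assemble_def assemble_def
  by (intro recursive_Suc recursive_prod_encode recursive_const recursive_add recursive_diff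
      recursive_fst recursive_snd recursive_proj) simp_all

section \<open>Diagonalisation\<close>

theorem corollary2:
  shows "\<not> decidable_problem instance_code zmax_instances
    (\<lambda>(n, A\<^sub>1, A\<^sub>2, M). \<exists>w :: nat list. w \<noteq> [] \<and> set w \<subseteq> {1, 2} \<and>
       proportional (mat_list_prod n (map (\<lambda>i. if i = 1 then A\<^sub>1 else A\<^sub>2) w)) M)"
proof
  let ?P = "\<lambda>(n, A\<^sub>1, A\<^sub>2, M). \<exists>w :: nat list. w \<noteq> [] \<and> set w \<subseteq> {1, 2} \<and>
       proportional (mat_list_prod n (map (\<lambda>i. if i = 1 then A\<^sub>1 else A\<^sub>2) w)) M"
  assume "decidable_problem instance_code zmax_instances ?P"
  then obtain d where d: "\<And>i. i \<in> zmax_instances \<Longrightarrow> rec_eval d [instance_code i] (if ?P i then 1 else 0)"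
    unfolding decidable_problem_def by blast
  obtain s where s: "\<And>xs. length xs = 1 \<Longrightarrow> rec_eval s xs (self_assemble (xs ! 0))"
    using recursive_self_assemble unfolding recursive_def by blast
  define f where "f = RComp d [s]"
  obtain T where T: "finite T" "T \<noteq> {}"
    "\<forall>x. (([0], (\<lambda>_. 0)(0 := x)), ([1], \<lambda>_. 0)) \<in> (step T)\<^sup>* \<longleftrightarrow> rec_eval f [x] 0"
    by (rule transition_system_for_recfun[of f])
  obtain ts where ts: "set ts = T" using T(1) finite_list by blast
  have "finite (\<Union>(p, a, q)\<in>T. op_regs a)"
    using T(1) by (auto simp: finite_op_regs)
  then obtain K where K: "\<forall>i\<in>\<Union>(p, a, q)\<in>T. op_regs a. i < K"
    unfolding finite_nat_set_iff_bounded by blast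
  have machine: "machine (Suc K) ts"
  proof
    show "op_regs a \<subseteq> {..<Suc K}" if "(p, a, q) \<in> set ts" for p a q
    proof
      fix i assume "i \<in> op_regs a"
      with that have "i \<in> (\<Union>(p, a, q)\<in>T. op_regs a)" unfolding ts by blast
      with K have "i < K" by (rule bspec)
      then show "i \<in> {..<Suc K}" by simp
    qed
  qed (use T(2) ts in auto)
  interpret M\<^sub>0: machine "Suc K" ts 0 by (rule machine)
  define c where "c = prod_encode (M\<^sub>0.n, prod_encode (zmax_mat_code M\<^sub>0.shift_mat,
    prod_encode (row_tail_code (Suc K) ts M\<^sub>0.n, prod_encode (rows_tail_code (Suc K) ts M\<^sub>0.n,
      zmax_mat_code M\<^sub>0.target))))"
  interpret M: machine "Suc K" ts c by (rule machine)
  define i where "i = (M.n, M.shift_mat, M.exec_mat, M.target)"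
  have "i \<in> zmax_instances" unfolding i_def by (rule M.instance_in_zmax_instances)
  then have "rec_eval d [instance_code i] (if ?P i then 1 else 0)" by (rule d)
  moreover have "rec_eval s [c] (instance_code i)"
  proof -
    have "self_assemble c = assemble M.n (zmax_mat_code M.shift_mat)
        (row_tail_code (Suc K) ts M.n) (rows_tail_code (Suc K) ts M.n) (zmax_mat_code M.target) c"
      unfolding c_def by (rule self_assemble)
    then have "self_assemble c = instance_code i"
      unfolding i_def M.instance_code_eq_assemble .
    then show ?thesis using s[of "[c]"] by simp
  qed
  ultimately have f: "rec_eval f [c] (if ?P i then 1 else 0)"
    unfolding f_def by (intro rec_eval.comp[where ys = "[instance_code i]"]) simp_all
  have P: "?P i \<longleftrightarrow> rec_eval f [c] 0"
    unfolding i_def prod.case M.product_proportional_iff ts input_def T(3)[rule_format] ..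
  show False
  proof (cases "?P i")
    case True
    with f have "rec_eval f [c] 1" by (simp only: if_True)
    moreover from True P have "rec_eval f [c] 0" by (rule_tac iffD1)
    ultimately show False using rec_eval_deterministic by fastforce
  next
    case False
    with f have "rec_eval f [c] 0" by (simp only: if_False)
    with False P show False by (rule_tac notE[OF False iffD2])
  qed
qed

end
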